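(* Let $j>0$, let $\rho_{\rm init}\in C([0,1],\mathbb R_+)$ with $\int_0^1\rho_{\rm init}(r)dr=M$, and let $\rho_t$ be the hydrodynamic limit started from $\rho_{\rm init}$. Then $$\lim_{t\to\infty}\sup_{r\in[0,1]}\big|F(r;\rho_t)-F(r;\rho^{(M)})\big|=0.$$
   Context: Particle system: fix $j>0$. For $\varepsilon>0$ with $\varepsilon^{-1}$ a positive integer let $\Lambda_\varepsilon=\{0,1,\dots,\varepsilon^{-1}\}$; configurations are $\xi\in\mathbb N^{\Lambda_\varepsilon}$. The process $(\xi_t)_{t\ge0}$ is the Markov jump process with generator $L=L^0+L_b+L_a$, where $L^0f(\xi)=\frac12\sum_{x=0}^{\varepsilon^{-1}-1}[\xi(x)(f(\xi^{x,x+1})-f(\xi))+\xi(x+1)(f(\xi^{x+1,x})-f(\xi))]$ ($\xi^{x,y}$: one particle moved from $x$ to $y$), $L_bf(\xi)=j\varepsilon(f(\xi^+)-f(\xi))$ with $\xi^+(x)=\xi(x)+\mathbf 1_{x=0}$, $L_af(\xi)=j\varepsilon(f(\xi^-)-f(\xi))$ with $\xi^-(x)=\xi(x)-\mathbf 1_{x=R_\xi}$, $R_\xi=\max\{y:\xi(y)>0\}$ ($L_af=0$ if $\xi\equiv0$). $P^{(\varepsilon)}_\xi$ is the law started from $\xi$. Notation: $F(r;u)=\int_r^1u(r')dr'$, $F_\varepsilon(x;\xi)=\sum_{y\ge x}\xi(y)$, $\mathcal A_\ell(x,\xi)=\frac1\ell\sum_{y=x}^{x+\ell-1}\xi(y)$,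 $\mathcal A'_\ell(x,\rho)=\frac1{\varepsilon\ell}\int_{\varepsilon x}^{\varepsilon(x+\ell)}\rho$. Admissible initial data: the edge of $\rho_{\rm init}$ (if it exists) is $R(0)=\min\{r:\rho_{\rm init}=0\text{ on }[r,1]\}$; with fixed $b<1$ close to $1$, $a>0$ small, $\ell=\lfloor\varepsilon^{-b}\rfloor$, a family $\xi=\xi^{(\varepsilon)}$ approximates $\rho_{\rm init}$ if $\max_{x\in[0,\varepsilon^{-1}-\ell+1]}|\mathcal A_\ell(x,\xi)-\mathcal A'_\ell(x,\rho_{\rm init})|\le\varepsilon^a$ and, if the edge exists, $|\varepsilon R_\xi-R(0)|\le\varepsilon^a$. Hydrodynamic limit (known from earlier work): there is $\rho_t(r)\ge0$, continuous in $(t,r)$, $\rho_0=\rho_{\rm init}$, such that for every approximating family $\xi$ and all $\zeta>0$, $t\ge0$: $\lim_{\varepsilon\to0}P^{(\varepsilon)}_\xi[\max_{x}|\varepsilon F_\varepsilon(x;\xi_{\varepsilon^{-2}t})-F(\varepsilon x;\rho_t)|\le\zeta]=1$. Linear profiles: $\rho^{(0)}\equiv0$; for $0<M<j$, $\rho^{(M)}(r)=2j(R-r)\mathbf 1_{r\le R}$ with $jR^2=M$; for $M\ge j$, $\rho^{(M)}(r)=-2jr+M+j$. In all cases $\int_0^1\rho^{(M)}=M$. *)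

theory Defs
  imports "HOL-Analysis.Analysis"
begin

text \<open>Lattice size: N = 1/eps, sites {0..N}. Configurations are nat => nat
  functions vanishing outside {0..N}.\<close>

type_synonym config = "nat \<Rightarrow> nat"

definition supported :: "nat \<Rightarrow> config \<Rightarrow> bool" where
  "supported N \<xi> \<longleftrightarrow> (\<forall>x>N. \<xi> x = 0)"

definition move :: "config \<Rightarrow> nat \<Rightarrow> nat \<Rightarrow> config" where
  "move \<xi> x y = (\<xi>(x := \<xi> x - 1))(y := \<xi> y + 1)"

definition add0 :: "config \<Rightarrow> config" where
  "add0 \<xi> = \<xi>(0 := \<xi> 0 + 1)"

definition rightmost :: "nat \<Rightarrow> config \<Rightarrow> nat" where
  "rightmost N \<xi> = (if \<exists>y\<le>N. \<xi> y > 0 then Max {y. y \<le> N \<and> \<xi> y > 0} else 0)"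

definition remR :: "nat \<Rightarrow> config \<Rightarrow> config" where
  "remR N \<xi> = \<xi>(rightmost N \<xi> := \<xi> (rightmost N \<xi>) - 1)"

text \<open>Transitions (rate, target) of the generator L = L^0 + L_b + L_a, eps = 1/N.\<close>
definition moves :: "real \<Rightarrow> nat \<Rightarrow> config \<Rightarrow> (real \<times> config) list" where
  "moves j N \<xi> =
     map (\<lambda>x. (real (\<xi> x) / 2, move \<xi> x (x+1))) [0..<N]
   @ map (\<lambda>x. (real (\<xi> (x+1)) / 2, move \<xi> (x+1) x)) [0..<N]
   @ [(j / real N, add0 \<xi>)]
   @ (if \<exists>y\<le>N. \<xi> y > 0 then [(j / real N, remR N \<xi>)] else [])"

definition qrate :: "real \<Rightarrow> nat \<Rightarrow> config \<Rightarrow> real" where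
  "qrate j N \<xi> = sum_list (map fst (moves j N \<xi>))"

text \<open>ptrans j N n t xi eta: probability that the jump process started at xi
  is at eta at time t after exactly n jumps (backward integral recursion).\<close>
primrec ptrans :: "nat \<Rightarrow> real \<Rightarrow> nat \<Rightarrow> real \<Rightarrow> config \<Rightarrow> config \<Rightarrow> real" where
  "ptrans 0 j N t \<xi> \<eta> = (if \<xi> = \<eta> then exp (- qrate j N \<xi> * t) else 0)"
| "ptrans (Suc n) j N t \<xi> \<eta> =
     integral {0..t} (\<lambda>s. exp (- qrate j N \<xi> * s) *
        sum_list (map (\<lambda>(r, \<zeta>). r * ptrans n j N (t - s) \<zeta> \<eta>) (moves j N \<xi>)))"

text \<open>Minimal transition function p_t(xi, eta) = P_xi[xi_t = eta].\<close>
definition trans_prob :: "real \<Rightarrow> nat \<Rightarrow> real \<Rightarrow> config \<Rightarrow> config \<Rightarrow> real" where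
  "trans_prob j N t \<xi> \<eta> = (\<Sum>n. ptrans n j N t \<xi> \<eta>)"

definition prob_at :: "real \<Rightarrow> nat \<Rightarrow> config \<Rightarrow> real \<Rightarrow> (config \<Rightarrow> bool) \<Rightarrow> real" where
  "prob_at j N \<xi> t A = infsum (\<lambda>\<eta>. trans_prob j N t \<xi> \<eta>) {\<eta>. supported N \<eta> \<and> A \<eta>}"

definition Fint :: "real \<Rightarrow> (real \<Rightarrow> real) \<Rightarrow> real" where
  "Fint r u = integral {r..1} u"

definition Feps :: "nat \<Rightarrow> nat \<Rightarrow> config \<Rightarrow> real" where
  "Feps N x \<xi> = (\<Sum>y\<in>{x..N}. real (\<xi> y))"

definition avg_xi :: "nat \<Rightarrow> nat \<Rightarrow> config \<Rightarrow> real" where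
  "avg_xi l x \<xi> = (\<Sum>y\<in>{x..<x+l}. real (\<xi> y)) / real l"

definition avg_rho :: "nat \<Rightarrow> nat \<Rightarrow> nat \<Rightarrow> (real \<Rightarrow> real) \<Rightarrow> real" where
  "avg_rho N l x \<rho> = integral {real x / real N .. real (x + l) / real N}
       (\<lambda>r. if 0 \<le> r \<and> r \<le> 1 then \<rho> r else 0) / (real l / real N)"

definition edge_set :: "(real \<Rightarrow> real) \<Rightarrow> real set" where
  "edge_set \<rho> = {r\<in>{0..1}. \<forall>s\<in>{r..1}. \<rho> s = 0}"

definition edge :: "(real \<Rightarrow> real) \<Rightarrow> real" where
  "edge \<rho> = Inf (edge_set \<rho>)"

definition block_len :: "real \<Rightarrow> nat \<Rightarrow> nat" where
  "block_len b N = nat \<lfloor>real N powr b\<rfloor>"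

definition approximates :: "real \<Rightarrow> real \<Rightarrow> (nat \<Rightarrow> config) \<Rightarrow> (real \<Rightarrow> real) \<Rightarrow> bool" where
  "approximates a b \<xi> \<rho> \<longleftrightarrow>
     (\<forall>N\<ge>1. supported N (\<xi> N)) \<and>
     (\<forall>\<^sub>F N in sequentially.
        (\<forall>x. x + block_len b N \<le> N + 1 \<longrightarrow>
           \<bar>avg_xi (block_len b N) x (\<xi> N) - avg_rho N (block_len b N) x \<rho>\<bar> \<le> (1 / real N) powr a) \<and>
        (edge_set \<rho> \<noteq> {} \<longrightarrow>
           \<bar>real (rightmost N (\<xi> N)) / real N - edge \<rho>\<bar> \<le> (1 / real N) powr a))"

definition hydro_limit :: "real \<Rightarrow> real \<Rightarrow> real \<Rightarrow> (real \<Rightarrow> real) \<Rightarrow> (real \<Rightarrow> real \<Rightarrow> real) \<Rightarrow> bool" where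
  "hydro_limit j a b \<rho>init \<rho> \<longleftrightarrow>
     continuous_on ({0..} \<times> {0..1}) (\<lambda>(t, r). \<rho> t r) \<and>
     (\<forall>t\<ge>0. \<forall>r\<in>{0..1}. \<rho> t r \<ge> 0) \<and>
     (\<forall>r\<in>{0..1}. \<rho> 0 r = \<rho>init r) \<and>
     (\<forall>\<xi>. approximates a b \<xi> \<rho>init \<longrightarrow>
        (\<forall>\<zeta>>0. \<forall>t\<ge>0.
          ((\<lambda>N. prob_at j N (\<xi> N) (real N ^ 2 * t)
               (\<lambda>\<eta>. \<forall>x\<le>N. \<bar>Feps N x \<eta> / real N - Fint (real x / real N) (\<rho> t)\<bar> \<le> \<zeta>))
            \<longlonglongrightarrow> 1)))"

definition rho_lin :: "real \<Rightarrow> real \<Rightarrow> real \<Rightarrow> real" where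
  "rho_lin j M r =
     (if M = 0 then 0
      else if M < j then (if r \<le> sqrt (M / j) then 2 * j * (sqrt (M / j) - r) else 0)
      else - 2 * j * r + M + j)"

end

theory Submission
  imports Defs
begin

text \<open>
  For \<open>1 \<le> y \<le> N\<close> the tail sums \<open>F y = Feps N y \<xi>\<close> evolve with drift
  \<open>\<Delta>F y / 2 - (j / N) 1{F y > 0}\<close>: a discrete parabolic obstacle problem, whose stationary
  solution is the tail of the linear profile. Its nonlinearity is monotone, so the squared
  \<open>L\<^sup>2\<close> distance to the stationary solution should decay exponentially on the diffusive scale.
  On the lattice the noise produced by single jumps is as large as the dissipation, so the
  distance is measured in the smoothed norm \<open>\<langle>w, (1 - \<kappa>\<Delta>)\<^sup>-\<^sup>1 w\<rangle>\<close> with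
  \<open>\<kappa> = (\<delta>N)\<^sup>2\<close>: the noise becomes negligible, and the error from smoothing the nonlinearity is of
  relative order \<open>\<delta>\<^sup>2\<close>. This yields an explicit supersolution of the backward equation, hence by
  Markov's inequality a configuration that is both close to the hydrodynamic limit at time
  \<open>t\<close> and has small energy. Letting \<open>N \<rightarrow> \<infinity>\<close> and then \<open>\<delta> \<rightarrow> 0\<close> bounds the
  squared \<open>L\<^sup>2\<close> distance of the limit by \<open>C exp (- t / 8)\<close>; since \<open>r \<mapsto> F(r; \<rho>\<^sub>t)\<close> is monotone and the
  stationary tail is Lipschitz, the uniform distance decays as well.
\<close>

section \<open>Discrete Laplacian and resolvent energy\<close>

text \<open>The natural size of the squared distance is \<open>N^3\<close>: \<open>N\<close> sites
  carrying tail sums of order \<open>N\<close>. Hops occur at total rate of order \<open>N\<close>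
  and each changes one tail sum by 1, so up to time \<open>N^2 * T\<close> they would add order
  \<open>N^3\<close> to the plain squared norm. In the smoothed norm a hop costs at most
  \<open>1 / sqrt \<kappa>\<close>, that is \<open>1 / (\<delta> * N)\<close>, and the total falls
  to order \<open>N^2 / \<delta>\<close>. Site 0 is left out of the inner product. Its tail sum is
  the particle number, which changes by injection and removal only and acts as a random boundary
  value; the square of its deviation grows to order \<open>N\<close> and is tracked by a separate
  term. The limit is known in probability only, so expected energies cannot be passed to it.
  Instead, a Markov bound shows that the energy cannot be large on all of the hydrodynamic event.
  The time is fixed while \<open>\<delta>\<close> tends to 0, because the error constants involve a
  bound on the density at that time.\<close>

definition ip :: "nat \<Rightarrow> (nat \<Rightarrow> real) \<Rightarrow> (nat \<Rightarrow> real) \<Rightarrow> real" where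
  "ip N a b = (\<Sum>y=1..N. a y * b y)"

text \<open>Subtraction on naturals truncates, so the value at 0 is not a second difference;
  \<open>ip\<close> sums over \<open>1..N\<close> and never sees it.\<close>

definition lap :: "(nat \<Rightarrow> real) \<Rightarrow> nat \<Rightarrow> real" where
  "lap v y = v (y - 1) - 2 * v y + v (Suc y)"

definition dirichlet :: "nat \<Rightarrow> (nat \<Rightarrow> real) \<Rightarrow> (nat \<Rightarrow> real) \<Rightarrow> real" where
  "dirichlet N a b = (\<Sum>y=0..N. (a (Suc y) - a y) * (b (Suc y) - b y))"

lemma ip_commute: "ip N a b = ip N b a"
  by (simp add: ip_def mult.commute)

lemma ip_add_left: "ip N (\<lambda>y. a y + b y) c = ip N a c + ip N b c"
  by (simp add: ip_def sum.distrib algebra_simps)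

lemma ip_add_right: "ip N c (\<lambda>y. a y + b y) = ip N c a + ip N c b"
  by (simp add: ip_def sum.distrib algebra_simps)

lemma ip_scale_right: "ip N a (\<lambda>y. r * b y) = r * ip N a b"
  by (simp add: ip_def sum_distrib_left algebra_simps)

lemma ip_diff_right: "ip N c (\<lambda>y. a y - b y) = ip N c a - ip N c b"
  by (simp add: ip_def sum_subtractf algebra_simps)

lemma ip_cong: "(\<And>y. 1 \<le> y \<Longrightarrow> y \<le> N \<Longrightarrow> a y = a' y) \<Longrightarrow> (\<And>y. 1 \<le> y \<Longrightarrow> y \<le> N \<Longrightarrow> b y = b' y) \<Longrightarrow> ip N a b = ip N a' b'"
  unfolding ip_def by (rule sum.cong) auto

lemma ip_self_nonneg: "0 \<le> ip N a a"
  by (simp add: ip_def sum_nonneg)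

lemma dirichlet_self_nonneg: "0 \<le> dirichlet N a a"
  by (simp add: dirichlet_def sum_nonneg)

lemma ip_young:
  assumes "s > 0"
  shows "2 * ip N a b \<le> s * ip N a a + ip N b b / s"
proof -
  have "2 * (x * y) \<le> s * (x * x) + (y * y) / s" for x y :: real
  proof -
    have "0 \<le> (s * x - y)^2 / s" using assms by simp
    also have "\<dots> = s * (x * x) - 2 * (x * y) + (y * y) / s"
      using assms by (simp add: field_simps power2_eq_square)
    finally show ?thesis by simp
  qed
  then have "(\<Sum>y=1..N. 2 * (a y * b y)) \<le> (\<Sum>y=1..N. s * (a y * a y) + (b y * b y) / s)"
    by (intro sum_mono) auto
  then show ?thesis
    by (simp add: ip_def sum.distrib sum_distrib_left sum_divide_distrib)
qed

lemma dirichlet_young: "2 * dirichlet N a b \<le> dirichlet N a a + dirichlet N b b"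
proof -
  have "2 * (x * y) \<le> x * x + y * y" for x y :: real
    using sum_squares_bound[of x y] by (simp add: power2_eq_square)
  then show ?thesis
    unfolding dirichlet_def sum_distrib_left sum.distrib[symmetric] by (intro sum_mono) auto
qed

section \<open>Summation by parts and discrete functional inequalities\<close>

lemma ip_lap:
  "ip N v (lap u) = v (Suc N) * (u (Suc N) - u N) - v 0 * (u 1 - u 0) - dirichlet N v u"
  by (induction N) (simp_all add: ip_def dirichlet_def lap_def algebra_simps)

lemma ip_lap_zero_boundary:
  assumes "v 0 = 0" "v (Suc N) = 0"
  shows "ip N v (lap u) = - dirichlet N v u"
  using ip_lap[of N v u] assms by simp

lemma ip_lap_swap:
  assumes "v 0 = 0" "v (Suc N) = 0"
  shows "ip N v (lap u) = ip N u (lap v) + v 1 * u 0 + v N * u (Suc N)"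
  using ip_lap[of N v u] ip_lap[of N u v] assms
  by (simp add: dirichlet_def mult.commute)

text \<open>Telescoping from the zero at 0 and Cauchy-Schwarz. The constant is not sharp, but it has
  the order \<open>N^2\<close> of diffusive time.\<close>

lemma poincare:
  assumes "v 0 = 0"
  shows "ip N v v \<le> (real N + 1)^2 * dirichlet N v v"
proof -
  have pt: "v y * v y \<le> (real N + 1) * dirichlet N v v" if "y \<le> N" for y
  proof -
    have "v y = (\<Sum>z<y. v (Suc z) - v z)"
      using assms sum_lessThan_telescope[of v y] by simp
    then have "v y * v y \<le> (\<Sum>z<y. (v (Suc z) - v z)^2) * real y"
      using sum_squared_le_sum_of_squares[of "\<lambda>z. v (Suc z) - v z" "{..<y}"]
      by (simp add: power2_eq_square)
    also have "\<dots> \<le> dirichlet N v v * (real N + 1)"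
    proof (rule mult_mono)
      show "(\<Sum>z<y. (v (Suc z) - v z)^2) \<le> dirichlet N v v"
        unfolding dirichlet_def power2_eq_square using that by (intro sum_mono2) auto
    qed (use that dirichlet_self_nonneg in auto)
    finally show ?thesis by (simp add: mult.commute)
  qed
  have "ip N v v \<le> (\<Sum>y=1..N. (real N + 1) * dirichlet N v v)"
    unfolding ip_def using pt by (intro sum_mono) auto
  also have "\<dots> = real N * ((real N + 1) * dirichlet N v v)" by simp
  also have "\<dots> \<le> (real N + 1) * ((real N + 1) * dirichlet N v v)"
    by (intro mult_right_mono) (use dirichlet_self_nonneg in auto)
  finally show ?thesis by (simp add: power2_eq_square algebra_simps)
qed

text \<open>The Dirichlet form is the inner product of \<open>v\<close> and \<open>- lap v\<close>.
  Young's inequality with weight \<open>1 / (N + 1)^2\<close> leaves a multiple of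
  \<open>ip N v v\<close> that the Poincare inequality absorbs into the left-hand side.\<close>

lemma dirichlet_le_lap:
  assumes "v 0 = 0" "v (Suc N) = 0"
  shows "dirichlet N v v \<le> (real N + 1)^2 * ip N (lap v) (lap v)"
proof -
  let ?L = "(real N + 1)^2"
  have L: "?L > 0" by simp
  have "2 * ip N v (\<lambda>y. - lap v y) \<le> (1 / ?L) * ip N v v + ip N (\<lambda>y. - lap v y) (\<lambda>y. - lap v y) / (1 / ?L)"
    using L by (intro ip_young) simp
  moreover have "ip N v (\<lambda>y. - lap v y) = dirichlet N v v"
    using ip_lap_zero_boundary[OF assms, of v] by (simp add: ip_def sum_negf)
  moreover have "(1 / ?L) * ip N v v \<le> dirichlet N v v"
    using poincare[of v N, OF assms(1)] L by (simp add: field_simps)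
  ultimately show ?thesis by (simp add: ip_def algebra_simps)
qed

text \<open>Affine functions are harmonic, so testing \<open>lap v\<close> against the one that is 1
  at 0 and 0 at \<open>N + 1\<close> isolates the boundary slope; Cauchy-Schwarz does the
  rest.\<close>

lemma boundary_slope_le_lap:
  assumes "v 0 = 0" "v (Suc N) = 0"
  shows "(v 1)^2 \<le> real N * ip N (lap v) (lap v)"
proof -
  let ?l = "\<lambda>y. (real N + 1 - real y) / (real N + 1)"
  have "lap ?l y = 0" if "1 \<le> y" for y
    using that by (simp add: lap_def of_nat_diff add_divide_distrib diff_divide_distrib)
  then have "ip N v (lap ?l) = 0" by (simp add: ip_def)
  moreover have "ip N v (lap ?l) = ip N ?l (lap v) + v 1"
    using ip_lap_swap[OF assms, of ?l] by simp
  ultimately have v1: "v 1 = - ip N ?l (lap v)" by simp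
  have "(ip N ?l (lap v))^2 \<le> (\<Sum>y=1..N. (?l y)^2) * (\<Sum>y=1..N. (lap v y)^2)"
    unfolding ip_def by (rule Cauchy_Schwarz_ineq_sum)
  also have "\<dots> \<le> real N * (\<Sum>y=1..N. (lap v y)^2)"
  proof (rule mult_right_mono)
    have "(?l y)^2 \<le> 1" if "y \<le> N" for y
      using that by (intro power_le_one) (auto simp: field_simps)
    then have "(\<Sum>y=1..N. (?l y)^2) \<le> (\<Sum>y=1..N. 1)" by (intro sum_mono) auto
    then show "(\<Sum>y=1..N. (?l y)^2) \<le> real N" by simp
  qed (simp add: sum_nonneg)
  finally show ?thesis unfolding v1 by (simp add: ip_def power2_eq_square)
qed

text \<open>Telescopes the squares and splits each difference of squares by Young's inequality. For
  \<open>s = sqrt \<kappa>\<close> and a resolvent \<open>v\<close>, the right-hand side is an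
  energy divided by \<open>sqrt \<kappa>\<close>.\<close>

lemma discrete_sobolev:
  assumes "s > 0" "v 0 = 0" "v (Suc N) = 0" "y \<le> N"
  shows "(v y)^2 \<le> s * dirichlet N v v + ip N v v / s"
proof -
  have "(v y)^2 = (\<Sum>z<y. (v (Suc z))^2 - (v z)^2)"
    using assms(2) sum_lessThan_telescope[of "\<lambda>z. (v z)^2" y] by simp
  also have "\<dots> \<le> (\<Sum>z<y. s * ((v (Suc z) - v z) * (v (Suc z) - v z)) + ((v (Suc z))^2 + (v z)^2) / (2 * s))"
  proof (rule sum_mono)
    fix z
    let ?a = "v (Suc z)" and ?b = "v z"
    \<comment> \<open>Expanding the first square yields \<open>(?a + ?b)^2 / (4 * s)\<close>; the
      second one completes it to \<open>(?a^2 + ?b^2) / (2 * s)\<close>.\<close>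
    have "0 \<le> (2 * s * (?a - ?b) - (?a + ?b))^2 / (4 * s) + (?a - ?b)^2 / (4 * s)" using assms(1) by simp
    also have "\<dots> = s * ((?a - ?b) * (?a - ?b)) - (?a^2 - ?b^2) + (?a^2 + ?b^2) / (2 * s)"
      using assms(1) by (simp add: field_simps power2_eq_square)
    finally show "?a^2 - ?b^2 \<le> s * ((?a - ?b) * (?a - ?b)) + (?a^2 + ?b^2) / (2 * s)" by simp
  qed
  also have "\<dots> \<le> (\<Sum>z=0..N. s * ((v (Suc z) - v z) * (v (Suc z) - v z)) + ((v (Suc z))^2 + (v z)^2) / (2 * s))"
    using assms by (intro sum_mono2) auto
  also have "\<dots> = s * dirichlet N v v + ((\<Sum>z=0..N. (v (Suc z))^2) + (\<Sum>z=0..N. (v z)^2)) / (2 * s)"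
    by (simp add: dirichlet_def sum.distrib sum_distrib_left sum_divide_distrib add_divide_distrib)
  also have "(\<Sum>z=0..N. (v (Suc z))^2) = ip N v v"
    using sum.shift_bounds_cl_Suc_ivl[of "\<lambda>z. (v z)^2" 0 N] assms(3) by (simp add: ip_def power2_eq_square)
  also have "(\<Sum>z=0..N. (v z)^2) = ip N v v"
    using assms(2) by (simp add: ip_def power2_eq_square sum.atLeast_Suc_atMost)
  finally show ?thesis by simp
qed

text \<open>The solution of \<open>lap u y = c * u y\<close> with initial values 0 and 1;
  \<open>shoot_part\<close> solves \<open>lap u y = c * (u y - w y)\<close> with initial values 0
  and 0.\<close>

fun shoot_hom :: "real \<Rightarrow> nat \<Rightarrow> real" where
  "shoot_hom c 0 = 0"
| "shoot_hom c (Suc 0) = 1"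
| "shoot_hom c (Suc (Suc n)) = (2 + c) * shoot_hom c (Suc n) - shoot_hom c n"

fun shoot_part :: "real \<Rightarrow> (nat \<Rightarrow> real) \<Rightarrow> nat \<Rightarrow> real" where
  "shoot_part c w 0 = 0"
| "shoot_part c w (Suc 0) = 0"
| "shoot_part c w (Suc (Suc n)) = (2 + c) * shoot_part c w (Suc n) - shoot_part c w n - c * w (Suc n)"

text \<open>The resolvent \<open>(1 - \<kappa> \<Delta>)\<^sup>-\<^sup>1\<close> of the Laplacian on \<open>{1..N}\<close> with zero boundary
  values at \<open>0\<close> and \<open>N + 1\<close>, obtained by shooting.\<close>
definition resolvent :: "real \<Rightarrow> nat \<Rightarrow> (nat \<Rightarrow> real) \<Rightarrow> nat \<Rightarrow> real" where
  "resolvent \<kappa> N w y = shoot_part (1 / \<kappa>) w y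
     - shoot_part (1 / \<kappa>) w (Suc N) / shoot_hom (1 / \<kappa>) (Suc N) * shoot_hom (1 / \<kappa>) y"

text \<open>Convexity keeps the homogeneous solution nondecreasing and positive. Its value at
  \<open>N + 1\<close> is the denominator in \<open>resolvent\<close>, so the right boundary
  condition can be met.\<close>

lemma shoot_hom_mono:
  assumes "c \<ge> 0"
  shows "shoot_hom c n \<le> shoot_hom c (Suc n) \<and> 0 < shoot_hom c (Suc n)"
proof (induction n)
  case (Suc n)
  have "0 \<le> c * shoot_hom c (Suc n)" using assms Suc by simp
  then show ?case using Suc by (simp add: algebra_simps)
qed simp

lemma shoot_part_add: "shoot_part c (\<lambda>y. a y + b y) n = shoot_part c a n + shoot_part c b n"
  by (induction c a n rule: shoot_part.induct) (simp_all add: algebra_simps)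

lemma resolvent_add: "resolvent \<kappa> N (\<lambda>y. a y + b y) = (\<lambda>y. resolvent \<kappa> N a y + resolvent \<kappa> N b y)"
  by (rule ext) (simp add: resolvent_def shoot_part_add algebra_simps add_divide_distrib)

definition energy :: "real \<Rightarrow> nat \<Rightarrow> (nat \<Rightarrow> real) \<Rightarrow> real" where
  "energy \<kappa> N w = ip N w (resolvent \<kappa> N w)"

section \<open>The smoothed norm\<close>

context
  fixes \<kappa> :: real and N :: nat
  assumes \<kappa>: "\<kappa> > 0"
begin

lemma resolvent_0: "resolvent \<kappa> N w 0 = 0"
  by (simp add: resolvent_def)

lemma resolvent_Suc_N: "resolvent \<kappa> N w (Suc N) = 0"
  using shoot_hom_mono[of "1 / \<kappa>" N] \<kappa> by (simp add: resolvent_def)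

lemma resolvent_eq:
  assumes "1 \<le> y"
  shows "w y = resolvent \<kappa> N w y - \<kappa> * lap (resolvent \<kappa> N w) y"
proof -
  obtain n where y: "y = Suc n" using assms by (cases y) auto
  define q where "q = shoot_part (1 / \<kappa>) w (Suc N) / shoot_hom (1 / \<kappa>) (Suc N)"
  have "resolvent \<kappa> N w = (\<lambda>y. shoot_part (1 / \<kappa>) w y - q * shoot_hom (1 / \<kappa>) y)"
    by (rule ext) (simp add: resolvent_def q_def)
  then show ?thesis unfolding y using \<kappa> by (simp add: lap_def field_simps)
qed

lemma ip_resolvent:
  "ip N w z = ip N (resolvent \<kappa> N w) z - \<kappa> * ip N z (lap (resolvent \<kappa> N w))"
proof -
  have "ip N z w = ip N z (\<lambda>y. resolvent \<kappa> N w y - \<kappa> * lap (resolvent \<kappa> N w) y)"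
    by (rule ip_cong) (auto intro: resolvent_eq)
  then show ?thesis by (simp add: ip_diff_right ip_scale_right ip_commute)
qed

lemma ip_resolvent_dirichlet:
  assumes "z 0 = 0" "z (Suc N) = 0"
  shows "ip N w z = ip N (resolvent \<kappa> N w) z + \<kappa> * dirichlet N z (resolvent \<kappa> N w)"
  using ip_resolvent[of w z] ip_lap_zero_boundary[OF assms] by simp

lemma energy_eq:
  "energy \<kappa> N w = ip N (resolvent \<kappa> N w) (resolvent \<kappa> N w)
     + \<kappa> * dirichlet N (resolvent \<kappa> N w) (resolvent \<kappa> N w)"
  unfolding energy_def
  by (rule ip_resolvent_dirichlet) (auto simp: resolvent_0 resolvent_Suc_N)

lemma energy_nonneg: "0 \<le> energy \<kappa> N w"
  using energy_eq \<kappa> by (simp add: ip_self_nonneg dirichlet_self_nonneg)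

lemma resolvent_symmetric: "ip N w (resolvent \<kappa> N w') = ip N w' (resolvent \<kappa> N w)"
proof -
  have "ip N w (resolvent \<kappa> N w') = ip N (resolvent \<kappa> N w) (resolvent \<kappa> N w')
     + \<kappa> * dirichlet N (resolvent \<kappa> N w') (resolvent \<kappa> N w)" for w w'
    by (rule ip_resolvent_dirichlet) (auto simp: resolvent_0 resolvent_Suc_N)
  note this[of w w'] this[of w' w]
  then show ?thesis
    by (simp add: ip_commute dirichlet_def mult.commute)
qed

text \<open>Symmetry of the resolvent merges the two cross terms. The change of energy in a jump
  thus splits exactly into a linear part, which makes up the drift, and a quadratic part, which is
  the noise.\<close>

lemma energy_add:
  "energy \<kappa> N (\<lambda>y. w y + e y) = energy \<kappa> N w + 2 * ip N (resolvent \<kappa> N w) e + energy \<kappa> N e"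
  using resolvent_symmetric[of w e]
  by (simp add: energy_def resolvent_add ip_add_left ip_add_right ip_commute)

lemma energy_le: "energy \<kappa> N w \<le> ip N w w"
proof -
  have "2 * energy \<kappa> N w \<le> ip N w w + ip N (resolvent \<kappa> N w) (resolvent \<kappa> N w)"
    using ip_young[of 1 N w "resolvent \<kappa> N w"] by (simp add: energy_def)
  moreover have "ip N (resolvent \<kappa> N w) (resolvent \<kappa> N w) \<le> energy \<kappa> N w"
    using energy_eq \<kappa> by (simp add: dirichlet_self_nonneg)
  ultimately show ?thesis by simp
qed

text \<open>Half of a duality formula: the energy is the supremum of the left-hand side over
  \<open>z\<close>, attained at the resolvent. Testing with a discretised profile recovers an
  ordinary squared norm from the smoothed one.\<close>

lemma energy_variational:
  assumes "z 0 = 0" "z (Suc N) = 0"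
  shows "2 * ip N w z - ip N z z - \<kappa> * dirichlet N z z \<le> energy \<kappa> N w"
proof -
  let ?v = "resolvent \<kappa> N w"
  have "2 * ip N ?v z \<le> ip N ?v ?v + ip N z z" using ip_young[of 1 N ?v z] by simp
  moreover have "\<kappa> * (2 * dirichlet N z ?v) \<le> \<kappa> * (dirichlet N z z + dirichlet N ?v ?v)"
    using \<kappa> dirichlet_young[of N z ?v] by (intro mult_left_mono) auto
  ultimately show ?thesis
    using ip_resolvent_dirichlet[OF assms, of w] energy_eq[of w] by (simp add: algebra_simps)
qed

text \<open>The energy of a point mass is \<open>s\<close> times its resolvent at \<open>y\<close>,
  whose square the Sobolev inequality bounds by the energy over \<open>sqrt \<kappa>\<close>; one
  factor of the energy cancels.\<close>

lemma energy_unit_le: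
  assumes "1 \<le> y" "y \<le> N"
  shows "energy \<kappa> N (\<lambda>z. if z = y then s else 0) \<le> s^2 / sqrt \<kappa>"
proof -
  let ?e = "\<lambda>z. if z = y then s else 0"
  let ?v = "resolvent \<kappa> N ?e"
  have s\<kappa>: "sqrt \<kappa> > 0" "sqrt \<kappa> * sqrt \<kappa> = \<kappa>" using \<kappa> by auto
  have E: "energy \<kappa> N ?e = s * ?v y"
    using assms by (simp add: energy_def ip_def if_distrib[of "\<lambda>x. x * _"] cong: if_cong)
  have "(?v y)^2 \<le> sqrt \<kappa> * dirichlet N ?v ?v + ip N ?v ?v / sqrt \<kappa>"
    using assms s\<kappa> by (intro discrete_sobolev) (auto simp: resolvent_0 resolvent_Suc_N)
  also have "\<dots> = energy \<kappa> N ?e / sqrt \<kappa>"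
    using s\<kappa> by (simp add: energy_eq field_simps)
  finally have *: "(?v y)^2 \<le> energy \<kappa> N ?e / sqrt \<kappa>" .
  have "(energy \<kappa> N ?e)^2 = s^2 * (?v y)^2" unfolding E by (simp add: power_mult_distrib)
  also have "\<dots> \<le> s^2 * (energy \<kappa> N ?e / sqrt \<kappa>)" by (intro mult_left_mono *) simp
  finally have "energy \<kappa> N ?e * energy \<kappa> N ?e \<le> (s^2 / sqrt \<kappa>) * energy \<kappa> N ?e"
    by (simp add: power2_eq_square)
  moreover have "0 \<le> s^2 / sqrt \<kappa>" using s\<kappa> by simp
  ultimately show ?thesis
    using energy_nonneg[of ?e] by (metis antisym_conv1 mult_right_le_imp_le)
qed

text \<open>The Laplacian produces \<open>- ?D - \<kappa> * ?B\<close>. The boundary value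
  \<open>w 0\<close> costs \<open>\<kappa> * ?B / 4\<close>, and so does replacing the resolvent by
  \<open>w\<close> in the product with \<open>\<psi>\<close>, which is done because a sign will be
  available for \<open>w\<close> only. The rest still covers half of
  \<open>?D + \<kappa> * ?B\<close>, which controls the energy by the Poincare inequalities.\<close>

lemma energy_dissipation:
  assumes "w (Suc N) = 0"
  shows "ip N (resolvent \<kappa> N w) (lap w) + 2 * ip N (resolvent \<kappa> N w) \<psi>
    \<le> - energy \<kappa> N w / (2 * (real N + 1)^2) + real N * (w 0)^2 / \<kappa>
       + 2 * ip N w \<psi> + 4 * \<kappa> * ip N \<psi> \<psi>"
proof -
  let ?v = "resolvent \<kappa> N w" and ?L = "(real N + 1)^2"
  let ?D = "dirichlet N ?v ?v" and ?B = "ip N (lap ?v) (lap ?v)"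
  have v0: "?v 0 = 0" "?v (Suc N) = 0" by (auto simp: resolvent_0 resolvent_Suc_N)
  have L: "?L > 0" by simp
  have 1: "ip N ?v (lap w) = ip N w (lap ?v) + ?v 1 * w 0"
    using ip_lap_swap[OF v0, of w] assms by simp
  have 2: "ip N w (lap ?v) = - ?D - \<kappa> * ?B"
    using ip_resolvent[of w "lap ?v"] ip_lap_zero_boundary[OF v0, of ?v] by simp
  have 3: "?v 1 * w 0 \<le> \<kappa> * ?B / 4 + real N * (w 0)^2 / \<kappa>"
  proof (cases "N = 0")
    case True
    then show ?thesis using v0(2) by (simp add: ip_def)
  next
    case False
    \<comment> \<open>Weighted so that \<open>boundary_slope_le_lap\<close> charges exactly a
      quarter of \<open>\<kappa> * ?B\<close>.\<close>
    have "0 \<le> (\<kappa> * ?v 1 - 2 * real N * w 0)^2 / (4 * real N * \<kappa>)" using \<kappa> by simp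
    also have "\<dots> = \<kappa> * ((?v 1)^2 / real N) / 4 - ?v 1 * w 0 + real N * (w 0)^2 / \<kappa>"
      using \<kappa> False by (simp add: field_simps power2_eq_square)
    finally have "?v 1 * w 0 \<le> \<kappa> * ((?v 1)^2 / real N) / 4 + real N * (w 0)^2 / \<kappa>" by simp
    moreover have "(?v 1)^2 / real N \<le> ?B"
      using boundary_slope_le_lap[OF v0] False by (simp add: field_simps)
    then have "\<kappa> * ((?v 1)^2 / real N) / 4 \<le> \<kappa> * ?B / 4"
      using \<kappa> by (intro divide_right_mono mult_left_mono) auto
    ultimately show ?thesis by linarith
  qed
  have 4: "2 * ip N ?v \<psi> \<le> 2 * ip N w \<psi> + \<kappa> * ?B / 4 + 4 * \<kappa> * ip N \<psi> \<psi>"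
  proof -
    have "2 * ip N (lap ?v) \<psi> \<le> (1/4) * ?B + ip N \<psi> \<psi> / (1/4)" by (rule ip_young) simp
    then have "\<kappa> * (2 * ip N \<psi> (lap ?v)) \<le> \<kappa> * (?B / 4 + 4 * ip N \<psi> \<psi>)"
      using \<kappa> by (intro mult_left_mono) (auto simp: ip_commute)
    then show ?thesis using ip_resolvent[of w \<psi>] by (simp add: algebra_simps)
  qed
  have 5: "energy \<kappa> N w / (2 * ?L) \<le> (?D + \<kappa> * ?B) / 2"
  proof -
    have "energy \<kappa> N w \<le> ?L * ?D + \<kappa> * (?L * ?B)"
      unfolding energy_eq using poincare[of ?v N, OF v0(1)] dirichlet_le_lap[OF v0] \<kappa>
      by (intro add_mono mult_left_mono) auto
    then have "energy \<kappa> N w \<le> ?L * (?D + \<kappa> * ?B)" by (simp add: algebra_simps)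
    then have "energy \<kappa> N w / (2 * ?L) \<le> ?L * (?D + \<kappa> * ?B) / (2 * ?L)"
      using L by (intro divide_right_mono) auto
    then show ?thesis using L by simp
  qed
  have "0 \<le> ?D" by (rule dirichlet_self_nonneg)
  then show ?thesis using 1 2 3 4 5 by simp
qed

end

section \<open>Supersolutions of the backward equation\<close>

definition generator :: "real \<Rightarrow> nat \<Rightarrow> (config \<Rightarrow> real) \<Rightarrow> config \<Rightarrow> real" where
  "generator j N f \<xi> = (\<Sum>(r, \<zeta>)\<leftarrow>moves j N \<xi>. r * (f \<zeta> - f \<xi>))"

lemma moves_rate_nonneg: "0 \<le> j \<Longrightarrow> (r, \<zeta>) \<in> set (moves j N \<xi>) \<Longrightarrow> 0 \<le> r"
  by (auto simp: moves_def split: if_splits)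

lemma rightmost_le: "rightmost N \<xi> \<le> N"
proof (cases "\<exists>y\<le>N. \<xi> y > 0")
  case True
  have "Max {y. y \<le> N \<and> \<xi> y > 0} \<in> {y. y \<le> N \<and> \<xi> y > 0}"
    using True by (intro Max_in) auto
  then show ?thesis using True by (simp add: rightmost_def)
next
  case False
  then show ?thesis unfolding rightmost_def by (subst if_not_P) auto
qed

lemma moves_supported:
  "supported N \<xi> \<Longrightarrow> (r, \<zeta>) \<in> set (moves j N \<xi>) \<Longrightarrow> supported N \<zeta>"
  using rightmost_le[of N \<xi>]
  by (auto simp: moves_def supported_def move_def add0_def remR_def split: if_splits)

lemma generator_qrate:
  "(\<Sum>(r, \<zeta>)\<leftarrow>moves j N \<xi>. r * f \<zeta>) = generator j N f \<xi> + qrate j N \<xi> * f \<xi>"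
proof -
  have "(\<Sum>(r, \<zeta>)\<leftarrow>ms. r * f \<zeta>) = (\<Sum>(r, \<zeta>)\<leftarrow>ms. r * (f \<zeta> - c)) + sum_list (map fst ms) * c"
    for ms :: "(real \<times> config) list" and c :: real
    by (induction ms) (auto simp: algebra_simps)
  then show ?thesis by (simp add: generator_def qrate_def)
qed

lemma generator_add: "generator j N (\<lambda>\<eta>. f \<eta> + g \<eta>) \<xi> = generator j N f \<xi> + generator j N g \<xi>"
proof -
  have "(\<Sum>(r, \<zeta>)\<leftarrow>ms. r * (f \<zeta> + g \<zeta> - (f \<xi> + g \<xi>)))
      = (\<Sum>(r, \<zeta>)\<leftarrow>ms. r * (f \<zeta> - f \<xi>)) + (\<Sum>(r, \<zeta>)\<leftarrow>ms. r * (g \<zeta> - g \<xi>))"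
    for ms :: "(real \<times> config) list"
    by (induction ms) (auto simp: algebra_simps)
  then show ?thesis by (simp add: generator_def)
qed

lemma generator_scale: "generator j N (\<lambda>\<eta>. c * f \<eta>) \<xi> = c * generator j N f \<xi>"
proof -
  have "(\<Sum>(r, \<zeta>)\<leftarrow>ms. r * (c * f \<zeta> - c * f \<xi>)) = c * (\<Sum>(r, \<zeta>)\<leftarrow>ms. r * (f \<zeta> - f \<xi>))"
    for ms :: "(real \<times> config) list"
    by (induction ms) (auto simp: algebra_simps)
  then show ?thesis by (simp add: generator_def)
qed

lemma generator_const: "generator j N (\<lambda>\<eta>. c) \<xi> = 0"
proof -
  have "(\<Sum>(r, \<zeta>)\<leftarrow>ms. r * (c - c)) = 0" for ms :: "(real \<times> config) list"
    by (induction ms) auto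
  then show ?thesis by (simp add: generator_def)
qed

section \<open>Expansion of the transition function in the number of jumps\<close>

lemma continuous_on_sum_list:
  fixes f :: "'b \<Rightarrow> 'a::topological_space \<Rightarrow> real"
  assumes "\<And>x. x \<in> set xs \<Longrightarrow> continuous_on S (f x)"
  shows "continuous_on S (\<lambda>t. \<Sum>x\<leftarrow>xs. f x t)"
  using assms by (induction xs) (auto intro!: continuous_intros)

lemma sum_sum_list_swap:
  fixes f :: "'a \<Rightarrow> 'b \<Rightarrow> real"
  shows "(\<Sum>a\<in>A. \<Sum>x\<leftarrow>xs. f a x) = (\<Sum>x\<leftarrow>xs. \<Sum>a\<in>A. f a x)"
  by (induction xs) (auto simp: sum.distrib)

text \<open>On the left \<open>t\<close> occurs inside the integrand; on the right only in a
  prefactor and in the upper limit, so continuity in \<open>t\<close> reduces to that of an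
  indefinite integral.\<close>

lemma integral_exp_convolution:
  fixes f :: "real \<Rightarrow> real"
  assumes "continuous_on {0..T} f" "t \<in> {0..T}"
  shows "integral {0..t} (\<lambda>s. exp (- q * s) * f (t - s))
    = exp (- q * t) * integral {0..t} (\<lambda>s. exp (q * s) * f s)"
proof -
  define I where "I = (\<lambda>s. integral {0..s} (\<lambda>s. exp (q * s) * f s))"
  have "continuous_on {0..t} (\<lambda>s. exp (q * s) * f s)"
    using assms by (intro continuous_intros continuous_on_subset[OF assms(1)]) auto
  then have I: "(I has_real_derivative exp (q * s) * f s) (at s within {0..t})" if "s \<in> {0..t}" for s
    unfolding I_def using that by (intro integral_has_real_derivative) auto
  have "((\<lambda>s. exp (- q * s) * f (t - s)) has_integral
      (- exp (- q * t) * I (t - t)) - (- exp (- q * t) * I (t - 0))) {0..t}"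
  proof (rule fundamental_theorem_of_calculus)
    fix s assume s: "s \<in> {0..t}"
    have img: "(\<lambda>s. t - s) ` {0..t} = {0..t}"
      by (auto simp: image_iff intro!: bexI[where x="t - _"])
    have "(I has_real_derivative exp (q * (t - s)) * f (t - s)) (at (t - s) within (\<lambda>s. t - s) ` {0..t})"
      unfolding img using s by (intro I) auto
    then have "((\<lambda>s. I (t - s)) has_real_derivative exp (q * (t - s)) * f (t - s) * (- 1)) (at s within {0..t})"
      by (intro DERIV_image_chain[where g="\<lambda>s. t - s" and f=I, unfolded o_def])
         (auto intro!: derivative_eq_intros)
    then have "((\<lambda>s. - exp (- q * t) * I (t - s)) has_real_derivative
        - exp (- q * t) * (exp (q * (t - s)) * f (t - s) * (- 1))) (at s within {0..t})"
      by (intro DERIV_cmult)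
    also have "- exp (- q * t) * (exp (q * (t - s)) * f (t - s) * (- 1))
        = (exp (- q * t) * exp (q * (t - s))) * f (t - s)" by simp
    also have "exp (- q * t) * exp (q * (t - s)) = exp (- q * s)"
      by (simp add: exp_add[symmetric] algebra_simps)
    finally show "((\<lambda>s. - exp (- q * t) * I (t - s)) has_vector_derivative
        exp (- q * s) * f (t - s)) (at s within {0..t})"
      by (simp add: has_real_derivative_iff_has_vector_derivative)
  qed (use assms in auto)
  then have "integral {0..t} (\<lambda>s. exp (- q * s) * f (t - s)) = exp (- q * t) * I t"
    by (intro integral_unique) (simp add: I_def)
  then show ?thesis by (simp add: I_def)
qed

lemma ptrans_continuous: "continuous_on {0..T} (\<lambda>t. ptrans n j N t \<xi> \<eta>)"
proof (induction n arbitrary: \<xi>)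
  case 0
  show ?case by (cases "\<xi> = \<eta>") (auto intro!: continuous_intros)
next
  case (Suc n)
  let ?f = "\<lambda>s. \<Sum>(r, \<zeta>)\<leftarrow>moves j N \<xi>. r * ptrans n j N s \<zeta> \<eta>"
  let ?q = "qrate j N \<xi>"
  have f: "continuous_on {0..T} ?f"
    by (rule continuous_on_sum_list) (auto intro!: continuous_intros Suc simp: case_prod_beta)
  have "continuous_on {0..T} (\<lambda>t. exp (- ?q * t) * integral {0..t} (\<lambda>s. exp (?q * s) * ?f s))"
    by (intro continuous_intros indefinite_integral_continuous_1 integrable_continuous_real f)
  then show ?case
    by (rule continuous_on_eq) (simp only: ptrans.simps integral_exp_convolution[OF f])
qed

lemma ptrans_continuous_reflect:
  "t \<ge> 0 \<Longrightarrow> continuous_on {0..t} (\<lambda>s. ptrans n j N (t - s) \<xi> \<eta>)"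
  by (rule continuous_on_compose2[OF ptrans_continuous[where T=t]]) (auto intro!: continuous_intros)

lemma ptrans_Suc_has_integral:
  assumes "t \<ge> 0"
  shows "((\<lambda>s. exp (- qrate j N \<xi> * s) * (\<Sum>(r, \<zeta>)\<leftarrow>moves j N \<xi>. r * ptrans n j N (t - s) \<zeta> \<eta>))
    has_integral ptrans (Suc n) j N t \<xi> \<eta>) {0..t}"
  unfolding ptrans.simps
  by (intro integrable_integral integrable_continuous_real continuous_intros continuous_on_sum_list)
     (auto simp: case_prod_beta intro!: continuous_intros ptrans_continuous_reflect assms)

lemma ptrans_nonneg:
  assumes "0 \<le> j" "0 \<le> t"
  shows "0 \<le> ptrans n j N t \<xi> \<eta>"
  using assms(2)
proof (induction n arbitrary: t \<xi>)
  case (Suc n)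
  have "0 \<le> (\<Sum>(r, \<zeta>)\<leftarrow>moves j N \<xi>. r * ptrans n j N (t - s) \<zeta> \<eta>)" if "s \<in> {0..t}" for s
    using that by (intro sum_list_nonneg)
      (auto intro!: mult_nonneg_nonneg Suc.IH intro: moves_rate_nonneg[OF assms(1)])
  then show ?case
    by (intro has_integral_nonneg[OF ptrans_Suc_has_integral[OF Suc.prems]] mult_nonneg_nonneg) auto
qed simp

text \<open>By induction on the number of jumps; neither non-explosion nor the forward equation
  is needed.\<close>
lemma ptrans_supersolution:
  fixes g g' :: "real \<Rightarrow> config \<Rightarrow> real"
  assumes j: "0 \<le> j"
    and deriv: "\<And>t \<xi>. ((\<lambda>t. g t \<xi>) has_real_derivative g' t \<xi>) (at t)"
    and super: "\<And>t \<xi>. 0 \<le> t \<Longrightarrow> supported N \<xi> \<Longrightarrow> generator j N (g t) \<xi> \<le> g' t \<xi>"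
    and init: "\<And>\<xi>. supported N \<xi> \<Longrightarrow> h \<xi> \<le> g 0 \<xi>"
    and g: "\<And>t \<xi>. 0 \<le> t \<Longrightarrow> supported N \<xi> \<Longrightarrow> 0 \<le> g t \<xi>"
    and S: "finite S" and t: "0 \<le> t" and \<xi>: "supported N \<xi>"
  shows "(\<Sum>\<eta>\<in>S. (\<Sum>k<n. ptrans k j N t \<xi> \<eta>) * h \<eta>) \<le> g t \<xi>"
  using t \<xi>
proof (induction n arbitrary: t \<xi>)
  case 0
  then show ?case using g by simp
next
  case (Suc n)
  let ?V = "\<lambda>t \<xi>. \<Sum>\<eta>\<in>S. (\<Sum>k<n. ptrans k j N t \<xi> \<eta>) * h \<eta>"
  let ?q = "qrate j N \<xi>"
  \<comment> \<open>The contribution of paths with at least one jump, to be written as an integral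
    over the time of the first jump.\<close>
  let ?int = "\<Sum>\<eta>\<in>S. (\<Sum>k<n. ptrans (Suc k) j N t \<xi> \<eta>) * h \<eta>"
  have "((\<lambda>s. \<Sum>\<eta>\<in>S. (\<Sum>k<n. exp (- ?q * s) * (\<Sum>(r, \<zeta>)\<leftarrow>moves j N \<xi>. r * ptrans k j N (t - s) \<zeta> \<eta>)) * h \<eta>)
      has_integral ?int) {0..t}"
    by (intro has_integral_sum S finite_lessThan has_integral_mult_left ptrans_Suc_has_integral Suc.prems)
  moreover have "(\<Sum>\<eta>\<in>S. (\<Sum>k<n. exp (- ?q * s) * (\<Sum>(r, \<zeta>)\<leftarrow>moves j N \<xi>. r * ptrans k j N (t - s) \<zeta> \<eta>)) * h \<eta>)
      = exp (- ?q * s) * (\<Sum>(r, \<zeta>)\<leftarrow>moves j N \<xi>. r * ?V (t - s) \<zeta>)" for s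
  proof -
    have "(\<Sum>\<eta>\<in>S. (\<Sum>k<n. exp (- ?q * s) * (\<Sum>(r, \<zeta>)\<leftarrow>moves j N \<xi>. r * ptrans k j N (t - s) \<zeta> \<eta>)) * h \<eta>)
      = exp (- ?q * s) * (\<Sum>\<eta>\<in>S. \<Sum>k<n. \<Sum>(r, \<zeta>)\<leftarrow>moves j N \<xi>. r * ptrans k j N (t - s) \<zeta> \<eta> * h \<eta>)"
      by (simp add: sum_distrib_left sum_distrib_right sum_list_const_mult[symmetric]
          sum_list_mult_const[symmetric] case_prod_beta algebra_simps)
    also have "(\<Sum>\<eta>\<in>S. \<Sum>k<n. \<Sum>(r, \<zeta>)\<leftarrow>moves j N \<xi>. r * ptrans k j N (t - s) \<zeta> \<eta> * h \<eta>)
      = (\<Sum>(r, \<zeta>)\<leftarrow>moves j N \<xi>. r * ?V (t - s) \<zeta>)"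
      by (simp add: sum_sum_list_swap split_def sum_distrib_left sum_distrib_right algebra_simps)
    finally show ?thesis .
  qed
  ultimately have int: "((\<lambda>s. exp (- ?q * s) * (\<Sum>(r, \<zeta>)\<leftarrow>moves j N \<xi>. r * ?V (t - s) \<zeta>))
      has_integral ?int) {0..t}" by simp
  \<comment> \<open>The integrand is the derivative in \<open>s\<close> of
    \<open>- exp (- ?q * s) * g (t - s) \<xi>\<close>. By the supersolution inequality it dominates
    the first-jump integrand, and the boundary term at \<open>s = t\<close> pays for the paths
    without a jump.\<close>
  have "((\<lambda>s. exp (- ?q * s) * (?q * g (t - s) \<xi> + g' (t - s) \<xi>)) has_integral
      (- exp (- ?q * t) * g (t - t) \<xi>) - (- exp (- ?q * 0) * g (t - 0) \<xi>)) {0..t}"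
  proof (rule fundamental_theorem_of_calculus)
    fix s assume "s \<in> {0..t}"
    have "((\<lambda>s. g (t - s) \<xi>) has_real_derivative g' (t - s) \<xi> * (- 1)) (at s)"
      by (rule DERIV_chain2[OF deriv]) (auto intro!: derivative_eq_intros)
    then have "((\<lambda>s. - exp (- ?q * s) * g (t - s) \<xi>) has_real_derivative
        exp (- ?q * s) * (?q * g (t - s) \<xi> + g' (t - s) \<xi>)) (at s)"
      by (auto intro!: derivative_eq_intros simp: algebra_simps)
    then show "((\<lambda>s. - exp (- ?q * s) * g (t - s) \<xi>) has_vector_derivative
        exp (- ?q * s) * (?q * g (t - s) \<xi> + g' (t - s) \<xi>)) (at s within {0..t})"
      by (simp add: has_real_derivative_iff_has_vector_derivative has_vector_derivative_at_within)
  qed (use Suc.prems in auto)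
  then have gint: "((\<lambda>s. exp (- ?q * s) * (?q * g (t - s) \<xi> + g' (t - s) \<xi>)) has_integral
      (g t \<xi> - exp (- ?q * t) * g 0 \<xi>)) {0..t}" by simp
  have "?int \<le> g t \<xi> - exp (- ?q * t) * g 0 \<xi>"
  proof (rule has_integral_le[OF int gint], rule mult_left_mono)
    fix s assume s: "s \<in> {0..t}"
    have "(\<Sum>(r, \<zeta>)\<leftarrow>moves j N \<xi>. r * ?V (t - s) \<zeta>) \<le> (\<Sum>(r, \<zeta>)\<leftarrow>moves j N \<xi>. r * g (t - s) \<zeta>)"
    proof (rule sum_list_mono, clarify)
      fix r \<zeta> assume m: "(r, \<zeta>) \<in> set (moves j N \<xi>)"
      show "r * ?V (t - s) \<zeta> \<le> r * g (t - s) \<zeta>"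
        using s by (intro mult_left_mono Suc.IH moves_supported[OF Suc.prems(2) m]
            moves_rate_nonneg[OF j m]) auto
    qed
    also have "\<dots> \<le> ?q * g (t - s) \<xi> + g' (t - s) \<xi>"
      using super[of "t - s" \<xi>] s Suc.prems by (simp add: generator_qrate)
    finally show "(\<Sum>(r, \<zeta>)\<leftarrow>moves j N \<xi>. r * ?V (t - s) \<zeta>) \<le> ?q * g (t - s) \<xi> + g' (t - s) \<xi>" .
  qed simp
  moreover have "(\<Sum>\<eta>\<in>S. ptrans 0 j N t \<xi> \<eta> * h \<eta>) \<le> exp (- ?q * t) * g 0 \<xi>"
  proof -
    have "(\<Sum>\<eta>\<in>S. ptrans 0 j N t \<xi> \<eta> * h \<eta>) = (\<Sum>\<eta>\<in>S. if \<xi> = \<eta> then exp (- ?q * t) * h \<xi> else 0)"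
      by (intro sum.cong) auto
    also have "\<dots> = (if \<xi> \<in> S then exp (- ?q * t) * h \<xi> else 0)" using S by simp
    also have "\<dots> \<le> exp (- ?q * t) * g 0 \<xi>"
      using init[OF Suc.prems(2)] g[of 0 \<xi>] Suc.prems by (auto intro!: mult_left_mono)
    finally show ?thesis .
  qed
  ultimately show ?case
    unfolding sum.lessThan_Suc_shift by (simp only: distrib_right sum.distrib)
qed

text \<open>Markov's inequality with a supersolution in place of the expectation; the sum over all
  configurations is reached through finite sets.\<close>

lemma prob_at_markov:
  fixes g g' :: "real \<Rightarrow> config \<Rightarrow> real"
  assumes j: "0 \<le> j"
    and deriv: "\<And>t \<xi>. ((\<lambda>t. g t \<xi>) has_real_derivative g' t \<xi>) (at t)"
    and super: "\<And>t \<xi>. 0 \<le> t \<Longrightarrow> supported N \<xi> \<Longrightarrow> generator j N (g t) \<xi> \<le> g' t \<xi>"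
    and init: "\<And>\<xi>. supported N \<xi> \<Longrightarrow> h \<xi> \<le> g 0 \<xi>"
    and g: "\<And>t \<xi>. 0 \<le> t \<Longrightarrow> supported N \<xi> \<Longrightarrow> 0 \<le> g t \<xi>"
    and t: "0 \<le> t" and \<xi>: "supported N \<xi>" and \<theta>: "0 < \<theta>"
    and A: "\<And>\<eta>. supported N \<eta> \<Longrightarrow> A \<eta> \<Longrightarrow> \<theta> \<le> h \<eta>"
  shows "\<theta> * prob_at j N \<xi> t A \<le> g t \<xi>"
proof -
  let ?p = "\<lambda>n \<eta>. \<Sum>k<n. ptrans k j N t \<xi> \<eta>"
  note nonneg = ptrans_nonneg[OF j t]
  \<comment> \<open>The constant 1 is itself a supersolution. This bounds the partial sums, so
    \<open>trans_prob\<close> is their limit and not the unspecified sum of a divergent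
    series.\<close>
  have "?p n \<eta> \<le> 1" for n \<eta>
    using ptrans_supersolution[of j "\<lambda>_ _. 1" "\<lambda>_ _. 0" N "\<lambda>_. 1" "{\<eta>}" t \<xi> n] j t \<xi>
    by (simp add: generator_const)
  then have "summable (\<lambda>n. ptrans n j N t \<xi> \<eta>)" for \<eta>
    by (intro summableI_nonneg_bounded[where x=1] nonneg)
  then have lim: "(\<lambda>n. ?p n \<eta>) \<longlonglongrightarrow> trans_prob j N t \<xi> \<eta>" for \<eta>
    unfolding trans_prob_def by (rule summable_LIMSEQ)
  have tp: "0 \<le> trans_prob j N t \<xi> \<eta>" for \<eta>
    by (rule LIMSEQ_le_const[OF lim]) (auto intro!: sum_nonneg nonneg)
  have fin: "(\<Sum>\<eta>\<in>S. trans_prob j N t \<xi> \<eta>) \<le> g t \<xi> / \<theta>"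
    if S: "finite S" "S \<subseteq> {\<eta>. supported N \<eta> \<and> A \<eta>}" for S
  proof -
    have "(\<lambda>n. \<Sum>\<eta>\<in>S. ?p n \<eta> * h \<eta>) \<longlonglongrightarrow> (\<Sum>\<eta>\<in>S. trans_prob j N t \<xi> \<eta> * h \<eta>)"
      by (intro tendsto_intros lim)
    then have "(\<Sum>\<eta>\<in>S. trans_prob j N t \<xi> \<eta> * h \<eta>) \<le> g t \<xi>"
      by (rule LIMSEQ_le_const2)
         (auto intro!: ptrans_supersolution[OF j deriv super init g S(1) t \<xi>])
    moreover have "(\<Sum>\<eta>\<in>S. trans_prob j N t \<xi> \<eta>) * \<theta> \<le> (\<Sum>\<eta>\<in>S. trans_prob j N t \<xi> \<eta> * h \<eta>)"
      unfolding sum_distrib_right using S(2) A by (intro sum_mono mult_left_mono tp) auto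
    ultimately show ?thesis using \<theta> by (simp add: pos_le_divide_eq)
  qed
  have "prob_at j N \<xi> t A \<le> g t \<xi> / \<theta>"
    unfolding prob_at_def
  proof (rule infsum_le_finite_sums[OF _ fin])
    show "(\<lambda>\<eta>. trans_prob j N t \<xi> \<eta>) summable_on {\<eta>. supported N \<eta> \<and> A \<eta>}"
      using fin tp by (intro nonneg_bdd_above_summable_on) (auto intro!: bdd_aboveI2)
  qed auto
  then show ?thesis using \<theta> by (simp add: field_simps)
qed

section \<open>Existence of approximating configurations\<close>

lemma rightmost_eqI:
  assumes "m \<le> N" "0 < \<xi> m" "\<And>y. m < y \<Longrightarrow> y \<le> N \<Longrightarrow> \<xi> y = 0"
  shows "rightmost N \<xi> = m"
proof -
  have "Max {y. y \<le> N \<and> \<xi> y > 0} = m"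
  proof (rule Max_eqI)
    show "y \<le> m" if "y \<in> {y. y \<le> N \<and> \<xi> y > 0}" for y
      using that assms(3)[of y] by (cases "m < y") auto
  qed (use assms in auto)
  then show ?thesis unfolding rightmost_def using assms(1,2) by auto
qed

text \<open>The cumulative profile is rounded rather than the density: each site receives a
  difference of consecutive floors. Block sums telescope, so their error stays bounded whatever the
  block length, and division by a length of order \<open>N powr b\<close> meets the tolerance
  because \<open>a < b\<close>.\<close>

lemma ex_approximates:
  fixes \<rho> :: "real \<Rightarrow> real"
  assumes cont: "continuous_on {0..1} \<rho>" and nonneg: "\<And>r. r \<in> {0..1} \<Longrightarrow> 0 \<le> \<rho> r"
    and a: "0 < a" "a < b" "a \<le> 1"
  shows "\<exists>\<xi>. approximates a b \<xi> \<rho> \<and>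
    (\<forall>N\<ge>1. \<bar>Feps N 0 (\<xi> N) - real N * integral {0..1} \<rho>\<bar> \<le> 1)"
proof -
  \<comment> \<open>The \<open>min\<close> extends the profile by zero beyond 1, as
    \<open>avg_rho\<close> does: the last block may end at \<open>(N + 1) / N\<close>.\<close>
  define I where "I = (\<lambda>r. integral {0..min r 1} \<rho>)"
  have int: "\<rho> integrable_on {u..v}" if "{u..v} \<subseteq> {0..1}" for u v
    by (rule integrable_continuous_real[OF continuous_on_subset[OF cont that]])
  have I_diff: "integral {u..v} (\<lambda>r. if 0 \<le> r \<and> r \<le> 1 then \<rho> r else 0) = I v - I u"
    if "0 \<le> u" "u \<le> v" for u v
  proof -
    have "integral {u..v} (\<lambda>r. if 0 \<le> r \<and> r \<le> 1 then \<rho> r else 0)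
        = integral {u..v} (\<lambda>r. if r \<in> {0..1} then \<rho> r else 0)" by simp
    also have "\<dots> = integral ({u..v} \<inter> {0..1}) \<rho>" by (simp only: integral_restrict_Int Int_commute)
    also have "\<dots> = I v - I u"
    proof (cases "u \<le> 1")
      case True
      then have eq: "{u..v} \<inter> {0..1} = {u..min v 1}" using that by auto
      have "integral {0..u} \<rho> + integral {u..min v 1} \<rho> = integral {0..min v 1} \<rho>"
        using True that by (intro Henstock_Kurzweil_Integration.integral_combine int) auto
      then show ?thesis unfolding eq using True by (simp add: I_def)
    next
      case False
      then have "{u..v} \<inter> {0..1} = {}" by auto
      then show ?thesis using False that by (simp add: I_def)
    qed
    finally show ?thesis .
  qed
  have I_mono: "I u \<le> I v" if "0 \<le> u" "u \<le> v" for u v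
  proof -
    have "0 \<le> integral {u..v} (\<lambda>r. if 0 \<le> r \<and> r \<le> 1 then \<rho> r else 0)"
    \<comment> \<open>A non-integrable function has \<open>integral\<close> 0, so the sign is right
      in either case.\<close>
    proof (cases "(\<lambda>r. if 0 \<le> r \<and> r \<le> 1 then \<rho> r else 0) integrable_on {u..v}")
      case True
      then show ?thesis using nonneg by (intro integral_nonneg) auto
    qed (simp add: not_integrable_integral)
    then show ?thesis using I_diff[OF that] by simp
  qed
  define e where "e = edge \<rho>"
  have e01: "0 \<le> e \<and> e \<le> 1" and I_edge: "I u = I v" if "edge_set \<rho> \<noteq> {}" "e < u" "u \<le> v" for u v
  proof -
    obtain r0 where r0: "r0 \<in> edge_set \<rho>" using \<open>edge_set \<rho> \<noteq> {}\<close> by blast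
    have bdd: "bdd_below (edge_set \<rho>)" by (rule bdd_belowI[of _ 0]) (auto simp: edge_set_def)
    show e: "0 \<le> e \<and> e \<le> 1"
      unfolding e_def edge_def
    proof
      show "0 \<le> Inf (edge_set \<rho>)"
        by (rule cInf_greatest[OF \<open>edge_set \<rho> \<noteq> {}\<close>]) (auto simp: edge_set_def)
      show "Inf (edge_set \<rho>) \<le> 1"
        using cInf_lower[OF r0 bdd] r0 by (auto simp: edge_set_def)
    qed
    obtain r where r: "r \<in> edge_set \<rho>" "r < u"
      using \<open>e < u\<close> cInf_less_iff[OF \<open>edge_set \<rho> \<noteq> {}\<close> bdd] unfolding e_def edge_def by blast
    have "integral {u..v} (\<lambda>r. if 0 \<le> r \<and> r \<le> 1 then \<rho> r else 0) = integral {u..v} (\<lambda>r. 0)"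
      using r by (intro Henstock_Kurzweil_Integration.integral_cong) (auto simp: edge_set_def)
    then show "I u = I v" using I_diff[of u v] e that by simp
  qed
  define m where "m = (\<lambda>N. if edge_set \<rho> = {} then 0 else nat \<lfloor>e * real N\<rfloor>)"
  have e01: "0 \<le> e \<and> e \<le> 1" if "edge_set \<rho> \<noteq> {}"
    using e01[OF that, of "e + 1" "e + 1"] by simp
  have mN: "m N \<le> N" for N
  proof (cases "edge_set \<rho> = {}")
    case False
    have "e * real N \<le> 1 * real N" using e01[OF False] by (intro mult_right_mono) auto
    then have "\<lfloor>e * real N\<rfloor> \<le> int N" by (simp add: floor_le_iff)
    then show ?thesis using False by (simp add: m_def)
  qed (simp add: m_def)
  define c where "c = (\<lambda>N x. \<lfloor>real N * I (real x / real N)\<rfloor>)"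
  have c_mono: "c N x \<le> c N (Suc x)" for N x
    unfolding c_def by (intro floor_mono mult_left_mono I_mono divide_right_mono) auto
  \<comment> \<open>Past the edge the cumulative profile is constant and the floor differences
    vanish. The extra particle makes \<open>m N\<close> the rightmost occupied site even when
    rounding leaves no particle near the edge.\<close>
  define \<xi> where "\<xi> = (\<lambda>N y. if y \<le> N then nat (c N (Suc y) - c N y) + (if y = m N then 1 else 0) else 0)"
  have block: "(\<Sum>y\<in>{x..<x+l}. real (\<xi> N y))
      = real_of_int (c N (x + l)) - real_of_int (c N x) + (if m N \<in> {x..<x+l} then 1 else 0)"
    if "x + l \<le> N + 1" for N x l
  proof -
    have "(\<Sum>y\<in>{x..<x+l}. real (\<xi> N y))
      = (\<Sum>y\<in>{x..<x+l}. (real_of_int (c N (Suc y)) - real_of_int (c N y)) + (if y = m N then 1 else 0))"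
      using that c_mono by (intro sum.cong) (auto simp: \<xi>_def)
    also have "\<dots> = real_of_int (c N (x + l)) - real_of_int (c N x) + (if m N \<in> {x..<x+l} then 1 else 0)"
      unfolding sum.distrib by (subst sum_Suc_diff') auto
    finally show ?thesis .
  qed
  have "approximates a b \<xi> \<rho>"
    unfolding approximates_def
  proof (intro conjI allI impI)
    show "supported N (\<xi> N)" for N by (simp add: supported_def \<xi>_def)
    \<comment> \<open>With the factor 3 the block length is at least
      \<open>3 * N powr a - 1\<close>, hence at least \<open>2 * N powr a\<close>, which turns a
      block error of 2 into the tolerance.\<close>
    have "\<forall>\<^sub>F N in sequentially. 3 \<le> real N powr (b - a)"
    proof -
      have "3 \<le> real N powr (b - a)" if "nat \<lceil>3 powr (1 / (b - a))\<rceil> \<le> N" for N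
      proof -
        have "3 = (3 powr (1 / (b - a))) powr (b - a)" using a by (simp add: powr_powr)
        also have "\<dots> \<le> real N powr (b - a)"
          using a that by (intro powr_mono2) (auto simp: nat_ceiling_le_eq)
        finally show ?thesis .
      qed
      then show ?thesis by (rule eventually_sequentiallyI)
    qed
    then show "\<forall>\<^sub>F N in sequentially.
      (\<forall>x. x + block_len b N \<le> N + 1 \<longrightarrow>
           \<bar>avg_xi (block_len b N) x (\<xi> N) - avg_rho N (block_len b N) x \<rho>\<bar> \<le> (1 / real N) powr a) \<and>
      (edge_set \<rho> \<noteq> {} \<longrightarrow>
           \<bar>real (rightmost N (\<xi> N)) / real N - edge \<rho>\<bar> \<le> (1 / real N) powr a)"
      using eventually_ge_at_top[of 1]
    proof eventually_elim
      case (elim N)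
      let ?l = "block_len b N"
      have Na: "(1 / real N) powr a = 1 / real N powr a"
        using elim by (simp add: powr_divide)
      have l: "2 * real N powr a \<le> real ?l"
      proof -
        have "1 \<le> real N powr a" using elim a by (intro ge_one_powr_ge_zero) auto
        moreover have "real N powr b = real N powr a * real N powr (b - a)"
          by (simp add: powr_add[symmetric])
        moreover have "real N powr a * 3 \<le> real N powr a * real N powr (b - a)"
          using elim by (intro mult_left_mono) auto
        moreover have "real N powr b < real ?l + 1"
          unfolding block_len_def by simp
        ultimately show ?thesis by linarith
      qed
      have Npos: "0 < real N powr a" using elim by simp
      have lpos: "0 < real ?l" using l Npos by linarith
      show ?case
      proof (intro conjI allI impI)
        fix x assume x: "x + ?l \<le> N + 1"
        let ?S = "\<Sum>y\<in>{x..<x+?l}. real (\<xi> N y)"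
        let ?D = "I (real (x + ?l) / real N) - I (real x / real N)"
        have rho: "avg_rho N ?l x \<rho> = real N * ?D / real ?l"
          unfolding avg_rho_def using elim by (subst I_diff) (auto intro!: divide_right_mono)
        \<comment> \<open>The two floors err by at most 1 together, the extra particle by at most
          1.\<close>
        have "\<bar>?S - real N * ?D\<bar> \<le> 2"
          unfolding block[OF x] c_def right_diff_distrib by (auto, linarith+)
        then have "\<bar>?S - real N * ?D\<bar> / real ?l \<le> 2 / real ?l"
          using lpos by (intro divide_right_mono) auto
        also have "\<dots> \<le> 2 / (2 * real N powr a)"
          by (intro divide_left_mono mult_pos_pos l lpos Npos) (use Npos in auto)
        also have "\<dots> = 1 / real N powr a" by simp
        finally show "\<bar>avg_xi ?l x (\<xi> N) - avg_rho N ?l x \<rho>\<bar> \<le> (1 / real N) powr a"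
          unfolding rho avg_xi_def Na diff_divide_distrib[symmetric] using lpos by simp
      next
        assume E: "edge_set \<rho> \<noteq> {}"
        have meq: "int (m N) = \<lfloor>e * real N\<rfloor>"
          using e01[OF E] E by (simp add: m_def)
        have "rightmost N (\<xi> N) = m N"
        proof (rule rightmost_eqI[OF mN])
          show "0 < \<xi> N (m N)" using mN by (simp add: \<xi>_def)
          fix y assume y: "m N < y" "y \<le> N"
          then have "e * real N < real y" using meq by linarith
          then have "e < real y / real N" using elim by (simp add: field_simps)
          then have "I (real y / real N) = I (real (Suc y) / real N)"
            using E elim by (intro I_edge) (auto intro!: divide_right_mono)
          then show "\<xi> N y = 0" using y by (simp add: \<xi>_def c_def)
        qed
        moreover have "\<bar>real (m N) - e * real N\<bar> \<le> 1" using meq by linarith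
        then have "\<bar>real (m N) - e * real N\<bar> / real N \<le> 1 / real N"
          by (intro divide_right_mono) auto
        then have "\<bar>real (m N) / real N - e\<bar> \<le> 1 / real N"
          using elim by (simp add: field_simps)
        moreover have "1 / real N \<le> (1 / real N) powr a"
        proof -
          have "real N powr a \<le> real N powr 1" using elim a by (intro powr_mono) auto
          then show ?thesis unfolding Na using elim Npos by (intro divide_left_mono) auto
        qed
        ultimately show "\<bar>real (rightmost N (\<xi> N)) / real N - edge \<rho>\<bar> \<le> (1 / real N) powr a"
          unfolding e_def by simp
      qed
    qed
  qed
  moreover have "\<bar>Feps N 0 (\<xi> N) - real N * integral {0..1} \<rho>\<bar> \<le> 1" if "1 \<le> N" for N
  proof -
    have "Feps N 0 (\<xi> N) = (\<Sum>y\<in>{0..<0+(N+1)}. real (\<xi> N y))"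
      unfolding Feps_def by (intro sum.cong) auto
    also have "\<dots> = real_of_int (c N (0 + (N + 1))) - real_of_int (c N 0) + 1"
      using mN[of N] by (subst block) auto
    also have "c N 0 = 0" by (simp add: c_def I_def)
    also have "c N (0 + (N + 1)) = \<lfloor>real N * integral {0..1} \<rho>\<rfloor>"
    proof -
      have "1 \<le> real (0 + (N + 1)) / real N" using that by (simp add: field_simps)
      then have "min (real (0 + (N + 1)) / real N) 1 = 1" by simp
      then show ?thesis unfolding c_def I_def by simp
    qed
    finally show ?thesis by linarith
  qed
  ultimately show ?thesis by blast
qed

section \<open>The stationary tail\<close>

text \<open>The integral of \<open>rho_lin j M\<close> from \<open>r\<close> to 1 in closed form.
  The truncated square treats both sides of the edge, and the case \<open>M = 0\<close>, at
  once.\<close>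

definition lin_tail :: "real \<Rightarrow> real \<Rightarrow> real \<Rightarrow> real" where
  "lin_tail j M r = (if M < j then j * (max 0 (sqrt (M / j) - r))^2 else (1 - r) * (M - j * r))"

lemma max_0_square_deriv: "((\<lambda>x::real. (max 0 x)^2) has_real_derivative 2 * max 0 x) (at x)"
  if "x \<noteq> 0"
proof (cases "x > 0")
  case True
  have "((\<lambda>x::real. x^2) has_real_derivative 2 * max 0 x) (at x)"
    using True by (auto intro!: derivative_eq_intros)
  then show ?thesis
    by (rule DERIV_cong_ev[THEN iffD1, rotated -1, OF _ refl _ refl])
       (use True in \<open>auto intro!: eventually_mono[OF eventually_nhds_in_open[of "{0<..}" x]]\<close>)
next
  case False
  have "((\<lambda>x::real. 0) has_real_derivative 2 * max 0 x) (at x)"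
    using False by auto
  then show ?thesis
    by (rule DERIV_cong_ev[THEN iffD1, rotated -1, OF _ refl _ refl])
       (use False that in \<open>auto intro!: eventually_mono[OF eventually_nhds_in_open[of "{..<0}" x]]\<close>)
qed

text \<open>The edge is the exceptional point of the fundamental theorem, so the truncated square
  has to be differentiated only away from it.\<close>

lemma Fint_rho_lin:
  assumes "0 < j" "0 \<le> M" "0 \<le> r" "r \<le> 1"
  shows "Fint r (rho_lin j M) = lin_tail j M r"
proof -
  let ?R = "sqrt (M / j)"
  have end1: "lin_tail j M 1 = 0"
  proof (cases "M < j")
    case True
    then have "?R \<le> 1" using assms by (simp add: field_simps)
    then show ?thesis using True by (simp add: lin_tail_def)
  qed (simp add: lin_tail_def)
  have "(rho_lin j M has_integral (- lin_tail j M 1 - - lin_tail j M r)) {r..1}"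
  proof (rule fundamental_theorem_of_calculus_interior_strong[where S="{?R}"])
    fix x assume x: "x \<in> {r<..<1} - {?R}"
    have "((\<lambda>r. - lin_tail j M r) has_real_derivative rho_lin j M x) (at x)"
    proof (cases "M < j")
      case True
      have "((\<lambda>r. (max 0 (?R - r))^2) has_real_derivative 2 * max 0 (?R - x) * (- 1)) (at x)"
        using x by (intro DERIV_chain2[OF max_0_square_deriv]) (auto intro!: derivative_eq_intros)
      then have "((\<lambda>r. - (j * (max 0 (?R - r))^2)) has_real_derivative
          - (j * (2 * max 0 (?R - x) * (- 1)))) (at x)"
        by (intro DERIV_minus DERIV_cmult)
      moreover have "- (j * (2 * max 0 (?R - x) * (- 1))) = rho_lin j M x"
        using True x assms by (auto simp: rho_lin_def)
      ultimately show ?thesis using True by (simp add: lin_tail_def)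
    next
      case False
      then show ?thesis using assms
        by (auto simp: lin_tail_def rho_lin_def algebra_simps intro!: derivative_eq_intros)
    qed
    then show "((\<lambda>r. - lin_tail j M r) has_vector_derivative rho_lin j M x) (at x)"
      by (simp add: has_real_derivative_iff_has_vector_derivative)
  next
    show "continuous_on {r..1} (\<lambda>r. - lin_tail j M r)"
      by (cases "M < j") (auto simp: lin_tail_def intro!: continuous_intros)
  qed (use assms in auto)
  then show ?thesis unfolding Fint_def using end1 by (simp add: integral_unique)
qed

lemma lin_tail_0: "0 < j \<Longrightarrow> 0 \<le> M \<Longrightarrow> lin_tail j M 0 = M"
  by (simp add: lin_tail_def)

lemma lin_tail_1: "0 < j \<Longrightarrow> 0 \<le> M \<Longrightarrow> lin_tail j M 1 = 0"
  using Fint_rho_lin[of j M 1] by (simp add: Fint_def)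

text \<open>The slope is at most \<open>2 * j\<close> for \<open>M < j\<close> and at most
  \<open>M + j\<close> otherwise; the constant covers both regimes.\<close>

lemma lin_tail_lipschitz:
  assumes "0 < j" "0 \<le> M" "x \<in> {0..1}" "y \<in> {0..1}"
  shows "\<bar>lin_tail j M x - lin_tail j M y\<bar> \<le> (M + 2 * j) * \<bar>x - y\<bar>"
proof (cases "M < j")
  case True
  let ?R = "sqrt (M / j)"
  have R: "?R \<le> 1" using True assms by (simp add: field_simps)
  let ?a = "max 0 (?R - x)" and ?b = "max 0 (?R - y)"
  have "lin_tail j M x - lin_tail j M y = j * ((?a + ?b) * (?a - ?b))"
    using True by (simp add: lin_tail_def power2_eq_square algebra_simps)
  then have "\<bar>lin_tail j M x - lin_tail j M y\<bar> = j * ((?a + ?b) * \<bar>?a - ?b\<bar>)"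
    using assms by (simp add: abs_mult)
  also have "\<dots> \<le> j * (2 * \<bar>x - y\<bar>)"
  proof (intro mult_left_mono mult_mono)
    have "?R - x \<le> 1" "?R - y \<le> 1"
      using R assms(3,4) by (simp_all only: atLeastAtMost_iff) linarith+
    then have "?a \<le> 1" "?b \<le> 1" by simp_all
    then show "?a + ?b \<le> 2" by linarith
  qed (use assms in auto)
  also have "\<dots> \<le> (M + 2 * j) * \<bar>x - y\<bar>"
    using assms by (simp add: algebra_simps)
  finally show ?thesis .
next
  case False
  have "lin_tail j M x - lin_tail j M y = (j * (x + y) - (M + j)) * (x - y)"
    using False by (simp add: lin_tail_def algebra_simps)
  then have "\<bar>lin_tail j M x - lin_tail j M y\<bar> = \<bar>j * (x + y) - (M + j)\<bar> * \<bar>x - y\<bar>"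
    by (simp add: abs_mult)
  also have "\<dots> \<le> (M + 2 * j) * \<bar>x - y\<bar>"
  proof (rule mult_right_mono)
    have "0 \<le> j * (x + y)" "j * (x + y) \<le> j * 2"
      using assms by (auto intro!: mult_left_mono)
    then show "\<bar>j * (x + y) - (M + j)\<bar> \<le> M + 2 * j" using assms by linarith
  qed simp
  finally show ?thesis .
qed

text \<open>For \<open>M \<ge> j\<close> this is not \<open>N\<close> times the sampled \<open>lin_tail\<close>, because it has to vanish at \<open>N + 1\<close>,
  where the particle tails do.\<close>
definition lattice_tail :: "real \<Rightarrow> real \<Rightarrow> nat \<Rightarrow> nat \<Rightarrow> real" where
  "lattice_tail j M N y =
     (if M < j then real N * lin_tail j M (real y / real N)
      else (real N + 1 - real y) * (M - j * real y / real N))"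

context
  fixes j M :: real and N :: nat
  assumes j: "0 < j" and M: "0 \<le> M" and N: "1 \<le> N"
begin

lemma lattice_tail_subcritical:
  assumes "M < j"
  shows "lattice_tail j M N y = j / real N * (max 0 (sqrt (M / j) * real N - real y))^2"
proof -
  have "max 0 (sqrt (M / j) * real N - real y) = real N * max 0 (sqrt (M / j) - real y / real N)"
    using N by (auto simp: max_def field_simps)
  then show ?thesis using assms N
    by (simp add: lattice_tail_def lin_tail_def power_mult_distrib) (simp add: power2_eq_square)
qed

lemma lattice_tail_Suc_N: "lattice_tail j M N (Suc N) = 0"
proof (cases "M < j")
  case True
  then have "sqrt (M / j) \<le> 1" using M j by (simp add: field_simps)
  then have "sqrt (M / j) * real N \<le> 1 * real N" by (intro mult_right_mono) auto
  then show ?thesis by (simp add: lattice_tail_subcritical[OF True])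
qed (simp add: lattice_tail_def)

lemma lattice_tail_nonneg: "y \<le> N \<Longrightarrow> 0 \<le> lattice_tail j M N y"
proof (cases "M < j")
  case True
  then show ?thesis using j by (simp add: lattice_tail_subcritical)
next
  case False
  assume "y \<le> N"
  then have "j * real y / real N \<le> j" using j N by (simp add: field_simps)
  then show ?thesis using False \<open>y \<le> N\<close> by (simp add: lattice_tail_def)
qed

lemma lattice_tail_le: "y \<le> N \<Longrightarrow> lattice_tail j M N y \<le> (real N + 1) * M"
proof (cases "M < j")
  case True
  have "max 0 (sqrt (M / j) - real y / real N) \<le> sqrt (M / j)" using j M by simp
  then have "lin_tail j M (real y / real N) \<le> j * (sqrt (M / j))^2"
    unfolding lin_tail_def using True j by (simp only: if_True) (intro mult_left_mono power_mono, auto)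
  also have "\<dots> = M" using j M by simp
  finally have "real N * lin_tail j M (real y / real N) \<le> real N * M" by (intro mult_left_mono) auto
  then show ?thesis using True M by (simp add: lattice_tail_def algebra_simps)
next
  case False
  assume "y \<le> N"
  have "0 \<le> j * real y / real N" using j N by simp
  moreover have "j * real y / real N \<le> j" using j N \<open>y \<le> N\<close> by (simp add: field_simps)
  ultimately have "(real N + 1 - real y) * (M - j * real y / real N) \<le> (real N + 1) * M"
    using False \<open>y \<le> N\<close> by (intro mult_mono) auto
  then show ?thesis using False by (simp add: lattice_tail_def)
qed

lemma lattice_tail_approx:
  assumes "y \<le> N"
  shows "\<bar>lattice_tail j M N y - real N * lin_tail j M (real y / real N)\<bar> \<le> M"
proof (cases "M < j")
  case True
  then show ?thesis using M by (simp add: lattice_tail_def)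
next
  case False
  have "lattice_tail j M N y - real N * lin_tail j M (real y / real N) = M - j * real y / real N"
    using False N by (simp add: lattice_tail_def lin_tail_def field_simps)
  moreover have "0 \<le> j * real y / real N" "j * real y / real N \<le> j"
    using j N assms by (auto simp: field_simps)
  ultimately show ?thesis using False by simp
qed

text \<open>At \<open>2 * j / N\<close> diffusion balances removal. The second difference of the
  truncated square has this value up to one unit before the edge; from there on the tail is at most
  1 once \<open>j \<le> N\<close>. The threshold 1 is the smallest positive value of a particle
  tail.\<close>

lemma lap_lattice_tail:
  assumes "1 \<le> y"
  shows "0 \<le> lap (lattice_tail j M N) y" "lap (lattice_tail j M N) y \<le> 2 * j / real N"
    and "j \<le> real N \<Longrightarrow> 1 < lattice_tail j M N y \<Longrightarrow> lap (lattice_tail j M N) y = 2 * j / real N"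
proof -
  obtain n where y: "y = Suc n" using assms by (cases y) auto
  have "0 \<le> lap (lattice_tail j M N) y \<and> lap (lattice_tail j M N) y \<le> 2 * j / real N \<and>
    (j \<le> real N \<longrightarrow> 1 < lattice_tail j M N y \<longrightarrow> lap (lattice_tail j M N) y = 2 * j / real N)"
  proof (cases "M < j")
    case True
    define x where "x = sqrt (M / j) * real N - real y"
    define D where "D = (max 0 (x + 1))^2 - 2 * (max 0 x)^2 + (max 0 (x - 1))^2"
    have lap: "lap (lattice_tail j M N) y = j / real N * D"
      by (simp add: lap_def lattice_tail_subcritical[OF True] y x_def D_def algebra_simps)
    have D: "0 \<le> D \<and> D \<le> 2 \<and> (1 \<le> x \<longrightarrow> D = 2)"
    proof -
      consider "1 \<le> x" | "0 \<le> x" "x < 1" | "- 1 \<le> x" "x < 0" | "x < - 1" by linarith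
      then show ?thesis
      proof cases
        case 2
        then have "D = 1 + x * (2 - x)" by (simp add: D_def power2_eq_square algebra_simps)
        moreover have "0 \<le> x * (2 - x)" using 2 by simp
        moreover have "x * (2 - x) = 1 - (1 - x)^2" by (simp add: power2_eq_square algebra_simps)
        then have "x * (2 - x) \<le> 1" by simp
        ultimately show ?thesis using 2 by simp
      next
        case 3
        then have "(x + 1)^2 \<le> 1" by (intro power_le_one) auto
        then show ?thesis using 3 by (simp add: D_def)
      qed (auto simp: D_def power2_eq_square algebra_simps)
    qed
    have jN: "0 < j / real N" using j N by simp
    have x: "1 \<le> x" if "j \<le> real N" "1 < lattice_tail j M N y"
    proof (rule ccontr)
      assume "\<not> 1 \<le> x"
      then have "(max 0 x)^2 \<le> 1" by (intro power_le_one) auto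
      then have "j / real N * (max 0 x)^2 \<le> 1 * 1"
        using that(1) j N by (intro mult_mono) auto
      then show False using that(2) by (simp add: lattice_tail_subcritical[OF True] x_def)
    qed
    show ?thesis
    proof (intro conjI impI)
      show "0 \<le> lap (lattice_tail j M N) y" unfolding lap using jN D by (intro mult_nonneg_nonneg) auto
      have "j / real N * D \<le> j / real N * 2" using jN D by (intro mult_left_mono) auto
      then show "lap (lattice_tail j M N) y \<le> 2 * j / real N"
        unfolding lap by (simp add: mult.commute)
      show "lap (lattice_tail j M N) y = 2 * j / real N" if "j \<le> real N" "1 < lattice_tail j M N y"
        unfolding lap using D x[OF that] by simp
    qed
  next
    case False
    have "lap (lattice_tail j M N) y = 2 * j / real N"
      using False N by (simp add: lap_def lattice_tail_def y field_simps)
    then show ?thesis using j N by simp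
  qed
  then show "0 \<le> lap (lattice_tail j M N) y" "lap (lattice_tail j M N) y \<le> 2 * j / real N"
    "j \<le> real N \<Longrightarrow> 1 < lattice_tail j M N y \<Longrightarrow> lap (lattice_tail j M N) y = 2 * j / real N"
    by auto
qed

end

section \<open>The generator on tail sums\<close>

lemma Feps_Suc: "y \<le> N \<Longrightarrow> Feps N y \<xi> = real (\<xi> y) + Feps N (Suc y) \<xi>"
  by (simp add: Feps_def sum.atLeast_Suc_atMost)

lemma Feps_beyond: "N < y \<Longrightarrow> Feps N y \<xi> = 0"
  by (simp add: Feps_def)

lemma Feps_nonneg: "0 \<le> Feps N y \<xi>"
  by (simp add: Feps_def sum_nonneg)

lemma Feps_antimono: "x \<le> y \<Longrightarrow> Feps N y \<xi> \<le> Feps N x \<xi>"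
  unfolding Feps_def by (intro sum_mono2) auto

lemma Feps_pos_iff: "0 < Feps N y \<xi> \<longleftrightarrow> (\<exists>x\<in>{y..N}. 0 < \<xi> x)"
proof -
  have "Feps N y \<xi> = 0 \<longleftrightarrow> (\<forall>x\<in>{y..N}. \<xi> x = 0)"
    unfolding Feps_def by (subst sum_nonneg_eq_0_iff) auto
  then have "Feps N y \<xi> \<noteq> 0 \<longleftrightarrow> (\<exists>x\<in>{y..N}. 0 < \<xi> x)" by (simp add: Bex_def Ball_def)
  then show ?thesis using Feps_nonneg[of N y \<xi>] by linarith
qed

lemma Feps_ge_1: "0 < Feps N y \<xi> \<Longrightarrow> 1 \<le> Feps N y \<xi>"
proof -
  have "Feps N y \<xi> = real (\<Sum>x\<in>{y..N}. \<xi> x)" by (simp add: Feps_def)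
  moreover assume "0 < Feps N y \<xi>"
  ultimately show ?thesis by (metis One_nat_def Suc_leI of_nat_0_less_iff of_nat_1 of_nat_le_iff)
qed

lemma Feps_fun_upd:
  "Feps N y (\<xi>(a := v)) = Feps N y \<xi> + (if y \<le> a \<and> a \<le> N then real v - real (\<xi> a) else 0)"
proof -
  have "Feps N y (\<xi>(a := v)) = (\<Sum>x\<in>{y..N}. real (\<xi> x) + (if x = a then real v - real (\<xi> a) else 0))"
    unfolding Feps_def by (intro sum.cong) auto
  also have "\<dots> = Feps N y \<xi> + (if y \<le> a \<and> a \<le> N then real v - real (\<xi> a) else 0)"
    unfolding sum.distrib Feps_def by simp
  finally show ?thesis .
qed

lemma Feps_move_right:
  "x < N \<Longrightarrow> 0 < \<xi> x \<Longrightarrow> Feps N y (move \<xi> x (x + 1)) = Feps N y \<xi> + (if y = Suc x then 1 else 0)"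
  by (auto simp: move_def Feps_fun_upd of_nat_diff)

lemma Feps_move_left:
  "x < N \<Longrightarrow> 0 < \<xi> (x + 1) \<Longrightarrow> Feps N y (move \<xi> (x + 1) x) = Feps N y \<xi> + (if y = Suc x then - 1 else 0)"
  by (auto simp: move_def Feps_fun_upd of_nat_diff)

lemma Feps_add0: "Feps N y (add0 \<xi>) = Feps N y \<xi> + (if y = 0 then 1 else 0)"
  by (auto simp: add0_def Feps_fun_upd)

text \<open>A tail sum is positive exactly up to the rightmost particle. Removal, which is nonlocal
  in the configuration, thereby becomes a pointwise function of the tail sums.\<close>

lemma Feps_remR:
  assumes "\<exists>y\<le>N. 0 < \<xi> y"
  shows "Feps N y (remR N \<xi>) = Feps N y \<xi> + (if 0 < Feps N y \<xi> then - 1 else 0)"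
proof -
  let ?A = "{y. y \<le> N \<and> \<xi> y > 0}"
  have R: "rightmost N \<xi> = Max ?A" using assms by (simp add: rightmost_def)
  have "Max ?A \<in> ?A" using assms by (intro Max_in) auto
  then have R1: "0 < \<xi> (rightmost N \<xi>)" "rightmost N \<xi> \<le> N" unfolding R by auto
  have R2: "x \<le> rightmost N \<xi>" if "x \<le> N" "0 < \<xi> x" for x
    unfolding R using that by (intro Max_ge) auto
  have "0 < Feps N y \<xi> \<longleftrightarrow> y \<le> rightmost N \<xi>"
  proof
    assume "0 < Feps N y \<xi>"
    then obtain x where "y \<le> x" "x \<le> N" "0 < \<xi> x" by (auto simp: Feps_pos_iff)
    then show "y \<le> rightmost N \<xi>" using R2[of x] by simp
  next
    assume "y \<le> rightmost N \<xi>"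
    then show "0 < Feps N y \<xi>"
      unfolding Feps_pos_iff using R1 by (intro bexI[of _ "rightmost N \<xi>"]) auto
  qed
  then show ?thesis using R1 by (simp add: remR_def Feps_fun_upd of_nat_diff)
qed

text \<open>For functions of the tail sums the case distinctions of \<open>moves\<close> disappear:
  a hop out of an empty site has rate 0, and in the empty configuration the removal term leaves all
  tail sums unchanged.\<close>

lemma generator_tail:
  fixes \<Phi> :: "(nat \<Rightarrow> real) \<Rightarrow> real" and j :: real and N :: nat and \<xi> :: config
  defines "F \<equiv> \<lambda>\<xi> y. Feps N y \<xi>"
  shows "generator j N (\<lambda>\<xi>. \<Phi> (F \<xi>)) \<xi> =
      (\<Sum>x<N. real (\<xi> x) / 2 * (\<Phi> (\<lambda>y. F \<xi> y + (if y = Suc x then 1 else 0)) - \<Phi> (F \<xi>)))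
    + (\<Sum>x<N. real (\<xi> (Suc x)) / 2 * (\<Phi> (\<lambda>y. F \<xi> y + (if y = Suc x then - 1 else 0)) - \<Phi> (F \<xi>)))
    + j / real N * (\<Phi> (\<lambda>y. F \<xi> y + (if y = 0 then 1 else 0)) - \<Phi> (F \<xi>))
    + j / real N * (\<Phi> (\<lambda>y. F \<xi> y + (if 0 < F \<xi> y then - 1 else 0)) - \<Phi> (F \<xi>))"
proof -
  have 1: "real (\<xi> x) / 2 * (\<Phi> (F (move \<xi> x (x + 1))) - \<Phi> (F \<xi>))
      = real (\<xi> x) / 2 * (\<Phi> (\<lambda>y. F \<xi> y + (if y = Suc x then 1 else 0)) - \<Phi> (F \<xi>))" if "x < N" for x
  proof (cases "\<xi> x = 0")
    case False
    then have "F (move \<xi> x (x + 1)) = (\<lambda>y. F \<xi> y + (if y = Suc x then 1 else 0))"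
      unfolding F_def using Feps_move_right[OF that] by blast
    then show ?thesis by simp
  qed simp
  have 2: "real (\<xi> (x + 1)) / 2 * (\<Phi> (F (move \<xi> (x + 1) x)) - \<Phi> (F \<xi>))
      = real (\<xi> (Suc x)) / 2 * (\<Phi> (\<lambda>y. F \<xi> y + (if y = Suc x then - 1 else 0)) - \<Phi> (F \<xi>))"
    if "x < N" for x
  proof (cases "\<xi> (x + 1) = 0")
    case False
    then have "F (move \<xi> (x + 1) x) = (\<lambda>y. F \<xi> y + (if y = Suc x then - 1 else 0))"
      unfolding F_def using Feps_move_left[OF that] by blast
    then show ?thesis by simp
  qed simp
  have 3: "\<not> (\<exists>y\<le>N. 0 < \<xi> y) \<Longrightarrow> (\<lambda>y. F \<xi> y + (if 0 < F \<xi> y then - 1 else 0)) = F \<xi>"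
    by (auto simp: F_def Feps_pos_iff)
  have 4: "\<exists>y\<le>N. 0 < \<xi> y \<Longrightarrow> F (remR N \<xi>) = (\<lambda>y. F \<xi> y + (if 0 < F \<xi> y then - 1 else 0))"
    unfolding F_def by (rule ext) (rule Feps_remR)
  have 5: "F (add0 \<xi>) = (\<lambda>y. F \<xi> y + (if y = 0 then 1 else 0))"
    unfolding F_def by (rule ext) (rule Feps_add0)
  have A: "(\<Sum>(r, \<zeta>)\<leftarrow>map (\<lambda>x. (real (\<xi> x) / 2, move \<xi> x (x+1))) [0..<N]. r * (\<Phi> (F \<zeta>) - \<Phi> (F \<xi>)))
    = (\<Sum>x<N. real (\<xi> x) / 2 * (\<Phi> (\<lambda>y. F \<xi> y + (if y = Suc x then 1 else 0)) - \<Phi> (F \<xi>)))"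
    unfolding map_map o_def prod.case interv_sum_list_conv_sum_set_nat
  proof (rule sum.cong)
    show "set [0..<N] = {..<N}" by auto
  qed (rule 1, simp)
  have B: "(\<Sum>(r, \<zeta>)\<leftarrow>map (\<lambda>x. (real (\<xi> (x+1)) / 2, move \<xi> (x+1) x)) [0..<N]. r * (\<Phi> (F \<zeta>) - \<Phi> (F \<xi>)))
    = (\<Sum>x<N. real (\<xi> (Suc x)) / 2 * (\<Phi> (\<lambda>y. F \<xi> y + (if y = Suc x then - 1 else 0)) - \<Phi> (F \<xi>)))"
    unfolding map_map o_def prod.case interv_sum_list_conv_sum_set_nat
  proof (rule sum.cong)
    show "set [0..<N] = {..<N}" by auto
  qed (rule 2, simp)
  show ?thesis
  proof (cases "\<exists>y\<le>N. 0 < \<xi> y")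
    case True
    then have "moves j N \<xi> = map (\<lambda>x. (real (\<xi> x) / 2, move \<xi> x (x+1))) [0..<N]
      @ map (\<lambda>x. (real (\<xi> (x+1)) / 2, move \<xi> (x+1) x)) [0..<N]
      @ [(j / real N, add0 \<xi>), (j / real N, remR N \<xi>)]"
      by (simp add: moves_def)
    then show ?thesis
      unfolding generator_def by (simp only: map_append sum_list_append A B) (simp add: 4[OF True] 5)
  next
    case False
    then have "moves j N \<xi> = map (\<lambda>x. (real (\<xi> x) / 2, move \<xi> x (x+1))) [0..<N]
      @ map (\<lambda>x. (real (\<xi> (x+1)) / 2, move \<xi> (x+1) x)) [0..<N]
      @ [(j / real N, add0 \<xi>)]"
      unfolding moves_def by (subst if_not_P) auto
    then show ?thesis
      unfolding generator_def 3[OF False] by (simp only: map_append sum_list_append A B) (simp add: 5)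
  qed
qed

text \<open>The particle number is a symmetric walk that cannot go below 0. Away from 0 the linear
  terms cancel; at 0 the upward step raises the square by at most 1, since
  \<open>m \<ge> 0\<close>.\<close>

lemma generator_mass:
  assumes "0 \<le> j" "0 \<le> m"
  shows "generator j N (\<lambda>\<xi>. (Feps N 0 \<xi> - m)^2) \<xi> \<le> 2 * j / real N"
proof -
  let ?w = "Feps N 0 \<xi> - m"
  have "generator j N (\<lambda>\<xi>. (Feps N 0 \<xi> - m)^2) \<xi> = j / real N * ((?w + 1)^2 - ?w^2)
      + j / real N * ((?w + (if 0 < Feps N 0 \<xi> then - 1 else 0))^2 - ?w^2)"
    using generator_tail[of j N "\<lambda>F. (F 0 - m)^2" \<xi>] by (simp add: algebra_simps)
  also have "\<dots> = j / real N * (((?w + 1)^2 - ?w^2)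
      + ((?w + (if 0 < Feps N 0 \<xi> then - 1 else 0))^2 - ?w^2))"
    by (rule distrib_left[symmetric])
  also have "((?w + 1)^2 - ?w^2) + ((?w + (if 0 < Feps N 0 \<xi> then - 1 else 0))^2 - ?w^2)
      = (if 0 < Feps N 0 \<xi> then 2 else 1 + 2 * ?w)"
    by (simp add: power2_eq_square algebra_simps)
  also have "j / real N * (if 0 < Feps N 0 \<xi> then 2 else 1 + 2 * ?w) \<le> j / real N * 2"
    using assms Feps_nonneg[of N 0 \<xi>] by (intro mult_left_mono) auto
  finally show ?thesis by (simp add: mult.commute)
qed

lemma generator_energy:
  fixes j M \<kappa> :: real and N :: nat and \<xi> :: config
  assumes j: "0 < j" and M: "0 \<le> M" and \<kappa>: "0 < \<kappa>" and N: "1 \<le> N" "j \<le> real N"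
  defines "w \<equiv> \<lambda>\<xi> y. Feps N y \<xi> - lattice_tail j M N y"
  shows "generator j N (\<lambda>\<xi>. energy \<kappa> N (w \<xi>)) \<xi> \<le> - energy \<kappa> N (w \<xi>) / (2 * (real N + 1)^2)
    + real N * (w \<xi> 0)^2 / \<kappa> + 4 * \<kappa> * j^2 / real N + Feps N 0 \<xi> / sqrt \<kappa> + j"
proof -
  let ?F = "\<lambda>y. Feps N y \<xi>" and ?\<phi> = "lattice_tail j M N"
  let ?v = "resolvent \<kappa> N (w \<xi>)"
  let ?e = "\<lambda>y. if 0 < ?F y then - 1 else (0::real)"
  \<comment> \<open>What is left of the drift of \<open>?F\<close> once half the Laplacian of the
    deviation is split off.\<close>
  define \<psi> where "\<psi> = (\<lambda>y. lap ?\<phi> y / 2 + j / real N * ?e y)"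
  have jN: "0 < j / real N" using j N by simp
  have w_fold: "(\<lambda>y. Feps N y \<xi> - ?\<phi> y) = w \<xi>" for \<xi>
    by (simp add: w_def)
  have inc: "energy \<kappa> N (\<lambda>y. ?F y + e y - ?\<phi> y) - energy \<kappa> N (w \<xi>) = 2 * ip N ?v e + energy \<kappa> N e" for e
  proof -
    have "(\<lambda>y. ?F y + e y - ?\<phi> y) = (\<lambda>y. w \<xi> y + e y)" by (auto simp: w_def)
    then show ?thesis using energy_add[OF \<kappa>, of N "w \<xi>" e] by simp
  qed
  have unit: "2 * ip N ?v (\<lambda>y. if y = Suc x then s else 0) + energy \<kappa> N (\<lambda>y. if y = Suc x then s else 0)
      \<le> 2 * s * ?v (Suc x) + 1 / sqrt \<kappa>" if "x < N" "s^2 = 1" for x s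
  proof -
    have "ip N ?v (\<lambda>y. if y = Suc x then s else 0) = s * ?v (Suc x)"
      using that(1) by (simp add: ip_def if_distrib[of "\<lambda>z. _ * z"] cong: if_cong)
    then show ?thesis using energy_unit_le[OF \<kappa>, of "Suc x" N s] that by simp
  qed
  \<comment> \<open>Injection changes only the tail sum at 0, which \<open>ip\<close> leaves out; it
    is felt through the boundary value \<open>w \<xi> 0\<close>.\<close>
  have zero: "2 * ip N ?v (\<lambda>y. if y = 0 then 1 else 0) + energy \<kappa> N (\<lambda>y. if y = 0 then 1 else 0) = 0"
    by (simp add: energy_def ip_def)
  \<comment> \<open>Removal may shift all \<open>N\<close> tail sums at once, but only at rate
    \<open>j / N\<close>, so the crude bound yields the constant \<open>j\<close>.\<close>
  have e_energy: "energy \<kappa> N ?e \<le> real N"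
  proof -
    have "ip N ?e ?e \<le> (\<Sum>y=1..N. 1)" unfolding ip_def by (intro sum_mono) auto
    then show ?thesis using energy_le[OF \<kappa>, of N ?e] by simp
  qed
  have "generator j N (\<lambda>\<xi>. energy \<kappa> N (w \<xi>)) \<xi> =
      (\<Sum>x<N. real (\<xi> x) / 2 * (2 * ip N ?v (\<lambda>y. if y = Suc x then 1 else 0) + energy \<kappa> N (\<lambda>y. if y = Suc x then 1 else 0)))
    + (\<Sum>x<N. real (\<xi> (Suc x)) / 2 * (2 * ip N ?v (\<lambda>y. if y = Suc x then - 1 else 0) + energy \<kappa> N (\<lambda>y. if y = Suc x then - 1 else 0)))
    + j / real N * (2 * ip N ?v ?e + energy \<kappa> N ?e)"
    using generator_tail[of j N "\<lambda>F. energy \<kappa> N (\<lambda>y. F y - ?\<phi> y)" \<xi>] zero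
    unfolding w_fold inc by simp
  also have "\<dots> \<le> (\<Sum>x<N. real (\<xi> x) / 2 * (2 * 1 * ?v (Suc x) + 1 / sqrt \<kappa>))
    + (\<Sum>x<N. real (\<xi> (Suc x)) / 2 * (2 * (- 1) * ?v (Suc x) + 1 / sqrt \<kappa>))
    + j / real N * (2 * ip N ?v ?e + real N)"
  proof -
    have "real (\<xi> x) / 2 * (2 * ip N ?v (\<lambda>y. if y = Suc x then 1 else 0) + energy \<kappa> N (\<lambda>y. if y = Suc x then 1 else 0))
        \<le> real (\<xi> x) / 2 * (2 * 1 * ?v (Suc x) + 1 / sqrt \<kappa>)" if "x < N" for x
      by (rule mult_left_mono[OF unit[OF that]]) auto
    then have "(\<Sum>x<N. real (\<xi> x) / 2 * (2 * ip N ?v (\<lambda>y. if y = Suc x then 1 else 0) + energy \<kappa> N (\<lambda>y. if y = Suc x then 1 else 0)))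
        \<le> (\<Sum>x<N. real (\<xi> x) / 2 * (2 * 1 * ?v (Suc x) + 1 / sqrt \<kappa>))"
      by (rule sum_mono) simp
    moreover have "real (\<xi> (Suc x)) / 2 * (2 * ip N ?v (\<lambda>y. if y = Suc x then - 1 else 0) + energy \<kappa> N (\<lambda>y. if y = Suc x then - 1 else 0))
        \<le> real (\<xi> (Suc x)) / 2 * (2 * (- 1) * ?v (Suc x) + 1 / sqrt \<kappa>)" if "x < N" for x
      by (rule mult_left_mono[OF unit[OF that]]) auto
    then have "(\<Sum>x<N. real (\<xi> (Suc x)) / 2 * (2 * ip N ?v (\<lambda>y. if y = Suc x then - 1 else 0) + energy \<kappa> N (\<lambda>y. if y = Suc x then - 1 else 0)))
        \<le> (\<Sum>x<N. real (\<xi> (Suc x)) / 2 * (2 * (- 1) * ?v (Suc x) + 1 / sqrt \<kappa>))"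
      by (rule sum_mono) simp
    moreover have "j / real N * (2 * ip N ?v ?e + energy \<kappa> N ?e) \<le> j / real N * (2 * ip N ?v ?e + real N)"
      using jN e_energy by (intro mult_left_mono) auto
    ultimately show ?thesis by (intro add_mono)
  qed
  also have "\<dots> = (\<Sum>x<N. ?v (Suc x) * (real (\<xi> x) - real (\<xi> (Suc x))))
    + (\<Sum>x<N. (real (\<xi> x) + real (\<xi> (Suc x))) / 2 / sqrt \<kappa>) + 2 * ip N ?v (\<lambda>y. j / real N * ?e y) + j"
  proof -
    have "real (\<xi> x) / 2 * (2 * 1 * ?v (Suc x) + 1 / sqrt \<kappa>)
        + real (\<xi> (Suc x)) / 2 * (2 * (- 1) * ?v (Suc x) + 1 / sqrt \<kappa>)
      = ?v (Suc x) * (real (\<xi> x) - real (\<xi> (Suc x))) + (real (\<xi> x) + real (\<xi> (Suc x))) / 2 / sqrt \<kappa>" for x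
      by (simp add: algebra_simps add_divide_distrib)
    moreover have "j / real N * (2 * ip N ?v ?e + real N) = 2 * ip N ?v (\<lambda>y. j / real N * ?e y) + j"
      using N by (simp only: ip_scale_right) (simp add: algebra_simps)
    ultimately show ?thesis by (simp only: sum.distrib[symmetric] add.assoc)
  qed
  finally have gen: "generator j N (\<lambda>\<xi>. energy \<kappa> N (w \<xi>)) \<xi>
    \<le> (\<Sum>x<N. ?v (Suc x) * (real (\<xi> x) - real (\<xi> (Suc x))))
    + (\<Sum>x<N. (real (\<xi> x) + real (\<xi> (Suc x))) / 2 / sqrt \<kappa>) + 2 * ip N ?v (\<lambda>y. j / real N * ?e y) + j" .
  \<comment> \<open>Occupation numbers are first differences of tail sums, so their differences are
    second differences.\<close>
  have drift: "(\<Sum>x<N. ?v (Suc x) * (real (\<xi> x) - real (\<xi> (Suc x)))) = ip N ?v (lap ?F)"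
    unfolding ip_def One_nat_def sum.atLeast1_atMost_eq by (intro sum.cong) (auto simp: lap_def Feps_Suc)
  have drift': "ip N ?v (lap ?F) = ip N ?v (lap (w \<xi>)) + 2 * ip N ?v (\<lambda>y. lap ?\<phi> y / 2)"
  proof -
    have "lap ?F = (\<lambda>y. lap (w \<xi>) y + 2 * (lap ?\<phi> y / 2))"
      by (rule ext) (simp add: lap_def w_def add_divide_distrib diff_divide_distrib)
    then show ?thesis by (simp only: ip_add_right ip_scale_right)
  qed
  have noise: "(\<Sum>x<N. (real (\<xi> x) + real (\<xi> (Suc x))) / 2 / sqrt \<kappa>) \<le> ?F 0 / sqrt \<kappa>"
  proof -
    have "(\<Sum>x<N. real (\<xi> x)) \<le> ?F 0" unfolding Feps_def by (intro sum_mono2) auto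
    moreover have "(\<Sum>x<N. real (\<xi> (Suc x))) = (\<Sum>x\<in>{1..N}. real (\<xi> x))"
      by (simp add: sum.atLeast1_atMost_eq)
    moreover have "(\<Sum>x\<in>{1..N}. real (\<xi> x)) \<le> ?F 0" unfolding Feps_def by (intro sum_mono2) auto
    ultimately have "(\<Sum>x<N. real (\<xi> x) + real (\<xi> (Suc x))) / 2 / sqrt \<kappa> \<le> ?F 0 / sqrt \<kappa>"
      using \<kappa> by (intro divide_right_mono) (auto simp: sum.distrib)
    then show ?thesis by (simp add: sum_divide_distrib)
  qed
  have "generator j N (\<lambda>\<xi>. energy \<kappa> N (w \<xi>)) \<xi>
      \<le> ip N ?v (lap (w \<xi>)) + 2 * ip N ?v \<psi> + ?F 0 / sqrt \<kappa> + j"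
  proof -
    have "g \<le> p + r + n + j"
      if "g \<le> a + b + c + j" "a = d" "d = p + q" "b \<le> n" "r = q + c" for g a b c d p q r n :: real
      using that by linarith
    from this[OF gen drift drift' noise] show ?thesis
      unfolding \<psi>_def ip_add_right distrib_left by blast
  qed
  moreover have "ip N ?v (lap (w \<xi>)) + 2 * ip N ?v \<psi> \<le> - energy \<kappa> N (w \<xi>) / (2 * (real N + 1)^2)
      + real N * (w \<xi> 0)^2 / \<kappa> + 2 * ip N (w \<xi>) \<psi> + 4 * \<kappa> * ip N \<psi> \<psi>"
    by (rule energy_dissipation[OF \<kappa>])
       (simp add: w_def Feps_beyond lattice_tail_Suc_N[OF j M N(1)])
  \<comment> \<open>Monotonicity of the obstacle nonlinearity, site by site. If
    \<open>?F y = 0\<close>, then \<open>w\<close> is nonpositive and \<open>\<psi>\<close>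
    nonnegative. If \<open>?F y > 0\<close> and \<open>w\<close> is nonnegative, then
    \<open>\<psi>\<close> is nonpositive. If \<open>?F y > 0\<close> and \<open>w\<close> is
    negative, integrality gives \<open>?\<phi> y > 1\<close>, hence
    \<open>\<psi> y = 0\<close>.\<close>
  moreover have "ip N (w \<xi>) \<psi> \<le> 0"
    unfolding ip_def
  proof (rule sum_nonpos)
    fix y assume y: "y \<in> {1..N}"
    note lap = lap_lattice_tail[OF j M N(1), of y]
    show "w \<xi> y * \<psi> y \<le> 0"
    proof (cases "0 < ?F y")
      case False
      then have "?F y = 0" using Feps_nonneg[of N y \<xi>] by simp
      then show ?thesis
        using lap(1) lattice_tail_nonneg[OF j M N(1), of y] y
        by (simp add: w_def \<psi>_def mult_nonneg_nonneg)
    next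
      case True
      then have \<psi>: "\<psi> y = lap ?\<phi> y / 2 - j / real N" by (simp add: \<psi>_def)
      show ?thesis
      proof (cases "0 \<le> w \<xi> y")
        case True
        have "\<psi> y \<le> 0" unfolding \<psi> using lap(2) y by (simp add: mult.commute)
        then show ?thesis using True by (simp add: mult_nonneg_nonpos)
      next
        case w: False
        then have "1 < ?\<phi> y" using Feps_ge_1[OF True] by (simp add: w_def)
        then have "\<psi> y = 0" unfolding \<psi> using lap(3) N y by simp
        then show ?thesis by simp
      qed
    qed
  qed
  moreover have "4 * \<kappa> * ip N \<psi> \<psi> \<le> 4 * \<kappa> * (j^2 / real N)"
  proof (rule mult_left_mono)
    have "\<psi> y * \<psi> y \<le> j / real N * (j / real N)" if "y \<in> {1..N}" for y
    proof -
      have "\<bar>\<psi> y\<bar> \<le> j / real N"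
        using lap_lattice_tail(1,2)[OF j M N(1), of y] that jN by (auto simp: \<psi>_def mult.commute)
      then have "\<bar>\<psi> y\<bar> * \<bar>\<psi> y\<bar> \<le> j / real N * (j / real N)" using jN by (intro mult_mono) auto
      then show ?thesis by (simp add: abs_mult_self_eq)
    qed
    then have "ip N \<psi> \<psi> \<le> (\<Sum>y=1..N. j / real N * (j / real N))"
      unfolding ip_def by (intro sum_mono) auto
    also have "\<dots> = j^2 / real N" using N by (simp add: power2_eq_square)
    finally show "ip N \<psi> \<psi> \<le> j^2 / real N" .
  qed (use \<kappa> in auto)
  ultimately show ?thesis by simp
qed

section \<open>Energy estimates\<close>

definition deviation :: "real \<Rightarrow> real \<Rightarrow> nat \<Rightarrow> config \<Rightarrow> nat \<Rightarrow> real" where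
  "deviation j M N \<xi> y = Feps N y \<xi> - lattice_tail j M N y"

lemma prob_at_mass:
  assumes "0 \<le> j" "0 \<le> m" "0 \<le> t" "supported N \<xi>" "0 < \<theta>"
    and "\<And>\<eta>. supported N \<eta> \<Longrightarrow> A \<eta> \<Longrightarrow> \<theta> \<le> (Feps N 0 \<eta> - m)^2"
  shows "\<theta> * prob_at j N \<xi> t A \<le> (Feps N 0 \<xi> - m)^2 + 2 * j / real N * t"
proof -
  let ?h = "\<lambda>\<xi>. (Feps N 0 \<xi> - m)^2"
  have deriv: "((\<lambda>t. x + c * t) has_real_derivative c) (at t)" for x c t :: real
    by (auto intro!: derivative_eq_intros)
  show ?thesis
  proof (rule prob_at_markov[where g="\<lambda>t \<xi>. ?h \<xi> + 2 * j / real N * t"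
        and g'="\<lambda>t \<xi>. 2 * j / real N" and h="?h"])
    show "((\<lambda>t. ?h \<xi> + 2 * j / real N * t) has_real_derivative 2 * j / real N) (at t)" for t \<xi>
      using deriv .
    show "generator j N (\<lambda>\<xi>. ?h \<xi> + 2 * j / real N * t) \<xi> \<le> 2 * j / real N" for t \<xi>
      using generator_mass[OF assms(1,2)] by (simp add: generator_add generator_const)
  qed (use assms in auto)
qed

text \<open>The supersolution. Sources are integrated in time without their decay; the growth rate
  \<open>2 * j / N\<close> of the squared mass deviation produces the term in
  \<open>t^2\<close>.\<close>

definition energy_bound :: "real \<Rightarrow> real \<Rightarrow> real \<Rightarrow> nat \<Rightarrow> real \<Rightarrow> config \<Rightarrow> real" where
  "energy_bound j M \<kappa> N t \<xi> =
     exp (- t / (2 * (real N + 1)^2)) * energy \<kappa> N (deviation j M N \<xi>)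
     + (real N / \<kappa> + 1 / sqrt \<kappa>) * t * (deviation j M N \<xi> 0)^2
     + (4 * \<kappa> * j^2 / real N + (1 + lattice_tail j M N 0) / sqrt \<kappa> + j) * t
     + (real N / \<kappa> + 1 / sqrt \<kappa>) * (j / real N) * t^2"

text \<open>Bounding the particle number through \<open>x \<le> x^2 + 1\<close> closes the
  inequality in the energy and the squared mass deviation.\<close>

lemma generator_energy_mass:
  assumes "0 < j" "0 \<le> M" "0 < \<kappa>" "1 \<le> N" "j \<le> real N"
  shows "generator j N (\<lambda>\<xi>. energy \<kappa> N (deviation j M N \<xi>)) \<xi>
    \<le> - energy \<kappa> N (deviation j M N \<xi>) / (2 * (real N + 1)^2)
      + (real N / \<kappa> + 1 / sqrt \<kappa>) * (deviation j M N \<xi> 0)^2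
      + (4 * \<kappa> * j^2 / real N + (1 + lattice_tail j M N 0) / sqrt \<kappa> + j)"
proof -
  let ?w = "deviation j M N \<xi> 0"
  have "2 * ?w \<le> ?w^2 + 1" using sum_squares_bound[of ?w 1] by simp
  moreover have "0 \<le> (?w)^2" by simp
  ultimately have "?w \<le> ?w^2 + 1" by linarith
  then have "Feps N 0 \<xi> \<le> ?w^2 + (1 + lattice_tail j M N 0)" by (simp add: deviation_def)
  then have "Feps N 0 \<xi> / sqrt \<kappa> \<le> (?w^2 + (1 + lattice_tail j M N 0)) / sqrt \<kappa>"
    using assms(3) by (intro divide_right_mono) auto
  then have "Feps N 0 \<xi> / sqrt \<kappa> \<le> ?w^2 / sqrt \<kappa> + (1 + lattice_tail j M N 0) / sqrt \<kappa>"
    by (simp only: add_divide_distrib)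
  moreover have "(real N / \<kappa> + 1 / sqrt \<kappa>) * ?w^2 = real N * ?w^2 / \<kappa> + ?w^2 / sqrt \<kappa>"
    by (simp add: algebra_simps)
  ultimately show ?thesis
    using generator_energy[OF assms(1-5), of \<xi>] unfolding deviation_def[abs_def] by linarith
qed

lemma prob_at_energy:
  assumes j: "0 < j" and M: "0 \<le> M" and \<kappa>: "0 < \<kappa>" and N: "1 \<le> N" "j \<le> real N"
    and t: "0 \<le> t" and \<xi>: "supported N \<xi>" and \<theta>: "0 < \<theta>"
    and A: "\<And>\<eta>. supported N \<eta> \<Longrightarrow> A \<eta> \<Longrightarrow> \<theta> \<le> energy \<kappa> N (deviation j M N \<eta>)"
  shows "\<theta> * prob_at j N \<xi> t A \<le> energy_bound j M \<kappa> N t \<xi>"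
    and "0 \<le> energy_bound j M \<kappa> N t \<xi>"
proof -
  let ?W = "\<lambda>\<xi>. energy \<kappa> N (deviation j M N \<xi>)" and ?m = "\<lambda>\<xi>. (deviation j M N \<xi> 0)^2"
  define \<beta> where "\<beta> = 1 / (2 * (real N + 1)^2)"
  define a where "a = real N / \<kappa> + 1 / sqrt \<kappa>"
  define c where "c = 4 * \<kappa> * j^2 / real N + (1 + lattice_tail j M N 0) / sqrt \<kappa> + j"
  have pos: "0 \<le> a" "0 \<le> c" "0 \<le> j / real N"
    using j \<kappa> N lattice_tail_nonneg[OF j M N(1), of 0] by (auto simp: a_def c_def)
  have g: "energy_bound j M \<kappa> N t \<xi> = exp (- \<beta> * t) * ?W \<xi> + (a * t * ?m \<xi> + (c * t + a * (j / real N) * t^2))"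
    for t \<xi> by (simp add: energy_bound_def \<beta>_def a_def c_def)
  have deriv: "((\<lambda>t. exp (- \<beta> * t) * W + (a * t * m + (c * t + a * k * t^2))) has_real_derivative
      - \<beta> * exp (- \<beta> * t) * W + a * m + c + 2 * a * k * t) (at t)" for W m k t :: real
    by (auto intro!: derivative_eq_intros)
  have nonneg: "0 \<le> energy_bound j M \<kappa> N t \<xi>" if "0 \<le> t" for t \<xi>
    unfolding g using that pos energy_nonneg[OF \<kappa>]
    by (intro add_nonneg_nonneg mult_nonneg_nonneg) auto
  then show "0 \<le> energy_bound j M \<kappa> N t \<xi>" using t by simp
  show "\<theta> * prob_at j N \<xi> t A \<le> energy_bound j M \<kappa> N t \<xi>"
  proof (rule prob_at_markov[where h="?W" and g'="\<lambda>t \<xi>. - \<beta> * exp (- \<beta> * t) * ?W \<xi> + a * ?m \<xi> + c + 2 * a * (j / real N) * t"])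
    show "((\<lambda>t. energy_bound j M \<kappa> N t \<xi>) has_real_derivative
        - \<beta> * exp (- \<beta> * t) * ?W \<xi> + a * ?m \<xi> + c + 2 * a * (j / real N) * t) (at t)" for t \<xi>
      unfolding g using deriv .
    show "generator j N (energy_bound j M \<kappa> N t) \<xi>
        \<le> - \<beta> * exp (- \<beta> * t) * ?W \<xi> + a * ?m \<xi> + c + 2 * a * (j / real N) * t" if "0 \<le> t" for t \<xi>
    proof -
      have "generator j N (energy_bound j M \<kappa> N t) \<xi>
          = exp (- \<beta> * t) * generator j N ?W \<xi> + a * t * generator j N ?m \<xi>"
        unfolding g[abs_def] by (simp only: generator_add generator_scale generator_const)
      also have "\<dots> \<le> exp (- \<beta> * t) * (- \<beta> * ?W \<xi> + a * ?m \<xi> + c) + a * t * (2 * j / real N)"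
      proof (intro add_mono mult_left_mono)
        show "generator j N ?W \<xi> \<le> - \<beta> * ?W \<xi> + a * ?m \<xi> + c"
          using generator_energy_mass[OF j M \<kappa> N, of \<xi>] by (simp add: \<beta>_def a_def c_def)
        show "generator j N ?m \<xi> \<le> 2 * j / real N"
          unfolding deviation_def
          by (rule generator_mass) (use j lattice_tail_nonneg[OF j M N(1), of 0] in auto)
      qed (use that pos in auto)
      also have "\<dots> = - \<beta> * exp (- \<beta> * t) * ?W \<xi> + exp (- \<beta> * t) * (a * ?m \<xi> + c) + 2 * a * (j / real N) * t"
        by (simp add: algebra_simps)
      also have "exp (- \<beta> * t) * (a * ?m \<xi> + c) \<le> 1 * (a * ?m \<xi> + c)"
        using pos that by (intro mult_right_mono) (auto simp: \<beta>_def)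
      finally show ?thesis by (simp add: add.assoc)
    qed
  qed (use j t \<xi> \<theta> A nonneg in \<open>auto simp: g\<close>)
qed

text \<open>In diffusive scaling only the decayed initial energy and the smoothing error keep the
  order \<open>N^3\<close>; noise, mass fluctuations and removal are of order \<open>N^2\<close>.
  The rate 1/8 comes from \<open>2 * (N + 1)^2 \<le> 8 * N^2\<close>.\<close>

lemma energy_bound_le:
  assumes j: "0 < j" and M: "0 \<le> M" and \<delta>: "0 < \<delta>" and N: "1 \<le> N" and T: "0 \<le> T"
    and \<xi>: "\<bar>Feps N 0 \<xi> - real N * M\<bar> \<le> 1"
  shows "energy_bound j M ((\<delta> * real N)^2) N (real N ^ 2 * T) \<xi>
    \<le> real N ^ 3 * (4 * (M + 1)^2 * exp (- T / 8) + 4 * \<delta>^2 * j^2 * T)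
      + real N ^ 2 * ((1 / \<delta>^2 + 1 / \<delta>) * (T * (1 + M)^2 + j * T^2) + T * ((1 + 2 * M) / \<delta> + j))"
proof -
  let ?w = "deviation j M N \<xi>" and ?\<kappa> = "(\<delta> * real N)^2" and ?t = "real N ^ 2 * T"
  let ?a = "1 / \<delta>^2 + 1 / \<delta>"
  have Npos: "0 < real N" using N by simp
  have \<kappa>: "0 < ?\<kappa>" "sqrt ?\<kappa> = \<delta> * real N" using \<delta> Npos by auto
  have NM: "real N * M \<le> 2 * real N * M" "M \<le> real N * M"
    using N M mult_right_mono[of 1 "real N" M] by auto
  have a: "real N / ?\<kappa> + 1 / sqrt ?\<kappa> = ?a / real N"
    unfolding \<kappa>(2) using \<delta> Npos by (simp add: field_simps power2_eq_square)
  have w: "\<bar>?w y\<bar> \<le> 2 * real N * (M + 1)" if "y \<le> N" for y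
  proof -
    have "Feps N y \<xi> \<le> real N * M + 1" using Feps_antimono[of 0 y N \<xi>] \<xi> by simp
    moreover have "0 \<le> Feps N y \<xi>" by (rule Feps_nonneg)
    moreover have "0 \<le> lattice_tail j M N y" by (rule lattice_tail_nonneg[OF j M N that])
    moreover have "lattice_tail j M N y \<le> (real N + 1) * M" by (rule lattice_tail_le[OF j M N that])
    moreover have "1 \<le> real N" using N by simp
    ultimately show ?thesis
      using NM unfolding deviation_def by (simp only: abs_le_iff) (simp add: algebra_simps)
  qed
  have W: "energy ?\<kappa> N ?w \<le> real N ^ 3 * (4 * (M + 1)^2)"
  proof -
    have "ip N ?w ?w \<le> (\<Sum>y=1..N. (2 * real N * (M + 1))^2)"
      unfolding ip_def
    proof (rule sum_mono)
      fix y assume "y \<in> {1..N}"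
      then have "\<bar>?w y\<bar> * \<bar>?w y\<bar> \<le> (2 * real N * (M + 1)) * (2 * real N * (M + 1))"
        using w[of y] by (intro mult_mono) auto
      then show "?w y * ?w y \<le> (2 * real N * (M + 1))^2"
        by (simp add: power2_eq_square abs_mult_self_eq)
    qed
    also have "\<dots> = real N ^ 3 * (4 * (M + 1)^2)"
      by (simp add: power2_eq_square power3_eq_cube algebra_simps)
    finally show ?thesis using energy_le[OF \<kappa>(1), of N ?w] by simp
  qed
  have E: "exp (- ?t / (2 * (real N + 1)^2)) \<le> exp (- T / 8)"
  proof -
    have "(real N + 1)^2 \<le> (2 * real N)^2" using N by (intro power_mono) auto
    then have "T * (2 * (real N + 1)^2) \<le> T * (8 * real N ^ 2)"
      using T by (intro mult_left_mono) (auto simp: power_mult_distrib)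
    then show ?thesis using N by (simp add: field_simps)
  qed
  have 1: "exp (- ?t / (2 * (real N + 1)^2)) * energy ?\<kappa> N ?w \<le> real N ^ 3 * (4 * (M + 1)^2 * exp (- T / 8))"
  proof -
    have "exp (- ?t / (2 * (real N + 1)^2)) * energy ?\<kappa> N ?w \<le> exp (- T / 8) * (real N ^ 3 * (4 * (M + 1)^2))"
      by (rule mult_mono[OF E W]) (use energy_nonneg[OF \<kappa>(1)] in auto)
    then show ?thesis by (simp add: algebra_simps)
  qed
  have w0: "(?w 0)^2 \<le> (1 + M)^2"
  proof -
    have "\<bar>lattice_tail j M N 0 - real N * M\<bar> \<le> M"
      using lattice_tail_approx[OF j M N, of 0] lin_tail_0[OF j M] by simp
    then have "\<bar>?w 0\<bar> \<le> 1 + M" using \<xi> unfolding deviation_def by linarith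
    then show ?thesis using M by (intro abs_le_square_iff[THEN iffD1]) auto
  qed
  have apos: "0 \<le> ?a" using \<delta> by simp
  have 2: "(real N / ?\<kappa> + 1 / sqrt ?\<kappa>) * ?t * (?w 0)^2 \<le> real N ^ 2 * (?a * (T * (1 + M)^2))"
  proof -
    have "(real N / ?\<kappa> + 1 / sqrt ?\<kappa>) * ?t * (?w 0)^2 = real N * (?a * (T * (?w 0)^2))"
      unfolding a using Npos by (simp add: power2_eq_square)
    also have "\<dots> \<le> real N ^ 2 * (?a * (T * (1 + M)^2))"
    proof (intro mult_mono mult_left_mono w0 T apos)
      show "real N \<le> real N ^ 2" using N by (simp add: power2_eq_square)
    qed (use apos T in auto)
    finally show ?thesis .
  qed
  have 3: "(4 * ?\<kappa> * j^2 / real N + (1 + lattice_tail j M N 0) / sqrt ?\<kappa> + j) * ?t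
      \<le> real N ^ 3 * (4 * \<delta>^2 * j^2 * T) + real N ^ 2 * (T * ((1 + 2 * M) / \<delta> + j))"
  proof -
    have "(1 + lattice_tail j M N 0) \<le> (1 + 2 * M) * real N"
    proof -
      have "(1 + lattice_tail j M N 0) \<le> 1 + (real N + 1) * M"
        using lattice_tail_le[OF j M N, of 0] by simp
      also have "\<dots> \<le> (1 + 2 * M) * real N"
        using N NM by (simp add: algebra_simps)
      finally show ?thesis .
    qed
    then have "(1 + lattice_tail j M N 0) / sqrt ?\<kappa> \<le> (1 + 2 * M) * real N / (\<delta> * real N)"
      unfolding \<kappa>(2) using \<delta> Npos by (intro divide_right_mono) auto
    also have "\<dots> = (1 + 2 * M) / \<delta>" using Npos by simp
    finally have "(4 * ?\<kappa> * j^2 / real N + (1 + lattice_tail j M N 0) / sqrt ?\<kappa> + j) * ?t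
      \<le> (4 * ?\<kappa> * j^2 / real N + (1 + 2 * M) / \<delta> + j) * ?t"
      using T by (intro mult_right_mono) auto
    also have "4 * ?\<kappa> * j^2 / real N = real N * (4 * \<delta>^2 * j^2)"
      using Npos by (simp add: power2_eq_square)
    finally show ?thesis by (simp add: algebra_simps power2_eq_square power3_eq_cube)
  qed
  have 4: "(real N / ?\<kappa> + 1 / sqrt ?\<kappa>) * (j / real N) * ?t^2 = real N ^ 2 * (?a * (j * T^2))"
    unfolding a using Npos by (simp add: power2_eq_square)
  show ?thesis
    using 1 2 3 4 unfolding energy_bound_def distrib_left by linarith
qed

section \<open>Decay of the hydrodynamic limit\<close>

text \<open>An interval of length \<open>l\<close> contains at least \<open>l * N - 1\<close>
  lattice points; counting from \<open>Suc ?p\<close> avoids site 0, which \<open>ip\<close>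
  omits.\<close>

lemma ip_lower_bound:
  fixes d :: "real \<Rightarrow> real"
  assumes N: "1 \<le> N" and \<alpha>: "0 \<le> \<alpha>" "\<alpha> + l \<le> 1" and l: "0 \<le> l" and h: "0 \<le> h"
    and d: "\<And>r. r \<in> {\<alpha>..\<alpha> + l} \<Longrightarrow> h \<le> \<bar>d r\<bar>"
    and z: "\<And>y. 1 \<le> y \<Longrightarrow> y \<le> N \<Longrightarrow> z y = real N * d (real y / real N)"
  shows "(l * real N - 1) * (real N * h)^2 \<le> ip N z z"
proof -
  let ?p = "nat \<lfloor>\<alpha> * real N\<rfloor>" and ?q = "nat \<lfloor>(\<alpha> + l) * real N\<rfloor>"
  have Npos: "0 < real N" using N by simp
  have p: "real ?p \<le> \<alpha> * real N" "\<alpha> * real N < real ?p + 1" and q: "real ?q \<le> (\<alpha> + l) * real N"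
    "(\<alpha> + l) * real N < real ?q + 1"
    using \<alpha> l by (auto simp: of_nat_nat)
  have "(\<alpha> + l) * real N \<le> 1 * real N" using \<alpha> by (intro mult_right_mono) auto
  then have qN: "?q \<le> N" using q by linarith
  have "l * real N - 1 \<le> real ?q - real ?p" using p q by (simp add: algebra_simps)
  also have "\<dots> \<le> real (card {Suc ?p..?q})" by simp
  finally have "(l * real N - 1) * (real N * h)^2 \<le> real (card {Suc ?p..?q}) * (real N * h)^2"
    by (intro mult_right_mono) auto
  also have "\<dots> = (\<Sum>y\<in>{Suc ?p..?q}. (real N * h)^2)" by simp
  also have "\<dots> \<le> (\<Sum>y\<in>{Suc ?p..?q}. z y * z y)"
  proof (rule sum_mono)
    fix y assume y: "y \<in> {Suc ?p..?q}"
    then have "real (Suc ?p) \<le> real y" "real y \<le> real ?q" by (simp_all only: of_nat_le_iff atLeastAtMost_iff)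
    then have "\<alpha> * real N \<le> real y" "real y \<le> (\<alpha> + l) * real N" using p q by (simp_all only: of_nat_Suc)
    then have "\<alpha> \<le> real y / real N" "real y / real N \<le> \<alpha> + l" using Npos by (auto simp: field_simps)
    then have "h \<le> \<bar>d (real y / real N)\<bar>" using d by auto
    then have "real N * h \<le> \<bar>z y\<bar>" using z[of y] y qN Npos by (simp add: abs_mult)
    then have "(real N * h)^2 \<le> \<bar>z y\<bar>^2" using h by (intro power_mono) auto
    then show "(real N * h)^2 \<le> z y * z y" by (simp add: power2_eq_square)
  qed
  also have "\<dots> \<le> ip N z z"
    unfolding ip_def using qN by (intro sum_mono2) auto
  finally show ?thesis .
qed

text \<open>An excess of the nonincreasing \<open>u\<close> over \<open>v\<close> shrinks at rate at
  most \<open>K\<close> to the left of \<open>r\<close>, a deficit to the right, so half of it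
  survives over a distance \<open>h / (2 * K)\<close>. As \<open>u\<close> and \<open>v\<close>
  agree at both ends, that end is at least \<open>h / K\<close> away and the interval fits.\<close>

lemma deviation_persists:
  fixes u v :: "real \<Rightarrow> real"
  assumes mono: "\<And>x y. 0 \<le> x \<Longrightarrow> x \<le> y \<Longrightarrow> y \<le> 1 \<Longrightarrow> u y \<le> u x"
    and lip: "\<And>x y. x \<in> {0..1} \<Longrightarrow> y \<in> {0..1} \<Longrightarrow> \<bar>v x - v y\<bar> \<le> K * \<bar>x - y\<bar>"
    and K: "0 < K" and ends: "u 0 = v 0" "u 1 = v 1" and r: "r \<in> {0..1}"
  defines "h \<equiv> \<bar>u r - v r\<bar>"
  shows "\<exists>\<alpha>\<ge>0. \<alpha> + h / (2 * K) \<le> 1 \<and> (\<forall>s\<in>{\<alpha>..\<alpha> + h / (2 * K)}. h / 2 \<le> \<bar>u s - v s\<bar>)"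
proof -
  define l where "l = h / (2 * K)"
  have l: "0 \<le> l" "K * l = h / 2" using K by (auto simp: h_def l_def)
  show ?thesis
  proof (cases "v r \<le> u r")
    case True
    then have h: "h = u r - v r" by (simp add: h_def)
    have left: "h - K * (r - s) \<le> u s - v s" if "0 \<le> s" "s \<le> r" for s
      using mono[of s r] lip[of s r] r that unfolding h by (auto simp: abs_le_iff algebra_simps)
    have "h \<le> K * r" using left[of 0] ends r by simp
    then have "K * (2 * l) \<le> K * r" using l by simp
    then have lr: "2 * l \<le> r" using mult_le_cancel_left_pos[OF K] by blast
    have "h / 2 \<le> \<bar>u s - v s\<bar>" if "s \<in> {r - l..r - l + l}" for s
    proof -
      have "K * (r - s) \<le> K * l" using that K by (intro mult_left_mono) auto
      moreover have "h - K * (r - s) \<le> u s - v s" using left[of s] that l lr r by auto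
      ultimately show ?thesis using l(2) by linarith
    qed
    then have "\<forall>s\<in>{r - l..r - l + l}. h / 2 \<le> \<bar>u s - v s\<bar>" by blast
    moreover have "0 \<le> r - l" "r - l + l \<le> 1" using r l lr by auto
    ultimately show ?thesis unfolding l_def[symmetric] by (intro exI[of _ "r - l"] conjI)
  next
    case False
    then have h: "h = v r - u r" by (simp add: h_def)
    have right: "h - K * (s - r) \<le> v s - u s" if "r \<le> s" "s \<le> 1" for s
      using mono[of r s] lip[of s r] r that unfolding h by (auto simp: abs_le_iff algebra_simps)
    have "h \<le> K * (1 - r)" using right[of 1] ends r by simp
    then have "K * (2 * l) \<le> K * (1 - r)" using l by simp
    then have lr: "2 * l \<le> 1 - r" using mult_le_cancel_left_pos[OF K] by blast
    have "h / 2 \<le> \<bar>u s - v s\<bar>" if "s \<in> {r..r + l}" for s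
    proof -
      have "K * (s - r) \<le> K * l" using that K by (intro mult_left_mono) auto
      moreover have "h - K * (s - r) \<le> v s - u s" using right[of s] that l lr r by auto
      ultimately show ?thesis using l(2) by linarith
    qed
    then have "\<forall>s\<in>{r..r + l}. h / 2 \<le> \<bar>u s - v s\<bar>" by blast
    moreover have "0 \<le> r" "r + l \<le> 1" using r l lr by auto
    ultimately show ?thesis unfolding l_def[symmetric] by (intro exI[of _ r] conjI)
  qed
qed

lemma Fint_antimono:
  assumes "continuous_on {0..1} f" "\<And>r. r \<in> {0..1} \<Longrightarrow> 0 \<le> f r" "0 \<le> x" "x \<le> y" "y \<le> 1"
  shows "Fint y f \<le> Fint x f"
  unfolding Fint_def using assms
  by (intro integral_subset_le integrable_continuous_real continuous_on_subset[OF assms(1)]) auto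

lemma Fint_lipschitz:
  assumes cont: "continuous_on {0..1} f" and B: "\<And>r. r \<in> {0..1} \<Longrightarrow> \<bar>f r\<bar> \<le> B"
    and "x \<in> {0..1}" "y \<in> {0..1}"
  shows "\<bar>Fint x f - Fint y f\<bar> \<le> B * \<bar>x - y\<bar>"
proof -
  have *: "\<bar>Fint x f - Fint y f\<bar> \<le> B * (y - x)" if "0 \<le> x" "x \<le> y" "y \<le> 1" for x y
  proof -
    have int: "f integrable_on {a..b}" if "{a..b} \<subseteq> {0..1}" for a b
      by (rule integrable_continuous_real[OF continuous_on_subset[OF cont that]])
    have "integral {x..y} f + integral {y..1} f = integral {x..1} f"
      using that by (intro Henstock_Kurzweil_Integration.integral_combine int) auto
    moreover have "norm (integral {x..y} f) \<le> B * (y - x)"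
      using that B by (intro integral_bound continuous_on_subset[OF cont]) auto
    ultimately show ?thesis by (simp add: Fint_def)
  qed
  show ?thesis
    using *[of x y] *[of y x] assms(3,4) by (cases "x \<le> y") (auto simp: abs_minus_commute)
qed

lemma le_if_le_inverse_nat:
  fixes x y C :: real
  assumes "\<forall>\<^sub>F N in sequentially. x \<le> y + C / real N"
  shows "x \<le> y"
proof (rule tendsto_lowerbound[OF _ assms])
  have "(\<lambda>N. y + C / real N) \<longlonglongrightarrow> y + 0"
    by (intro tendsto_intros lim_const_over_n)
  then show "(\<lambda>N. y + C / real N) \<longlonglongrightarrow> y" by simp
qed simp

lemma le_if_le_square:
  fixes x y C :: real
  assumes "\<And>\<delta>. 0 < \<delta> \<Longrightarrow> x \<le> y + C * \<delta>^2"
  shows "x \<le> y"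
proof (rule tendsto_lowerbound)
  have "((\<lambda>\<delta>. y + C * \<delta>^2) \<longlongrightarrow> y + C * 0^2) (at_right 0)"
    by (intro tendsto_intros)
  then show "((\<lambda>\<delta>. y + C * \<delta>^2) \<longlongrightarrow> y) (at_right 0)" by simp
  show "\<forall>\<^sub>F \<delta> in at_right 0. x \<le> y + C * \<delta>^2"
    using assms by (auto simp: eventually_at_right_less intro: eventually_mono[OF eventually_at_right_less])
qed simp

section \<open>The hydrodynamic limit at a fixed time\<close>

context
  fixes j M a b :: real and \<rho>init :: "real \<Rightarrow> real" and \<rho> :: "real \<Rightarrow> real \<Rightarrow> real"
    and \<xi> :: "nat \<Rightarrow> config" and T :: real
  assumes j: "0 < j" and M: "0 \<le> M" and T: "0 \<le> T"
    and hydro: "hydro_limit j a b \<rho>init \<rho>"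
    and \<xi>: "approximates a b \<xi> \<rho>init" "\<And>N. 1 \<le> N \<Longrightarrow> \<bar>Feps N 0 (\<xi> N) - real N * M\<bar> \<le> 1"
begin

definition hydro_event :: "real \<Rightarrow> nat \<Rightarrow> config \<Rightarrow> bool" where
  "hydro_event \<zeta> N \<eta> \<longleftrightarrow> (\<forall>x\<le>N. \<bar>Feps N x \<eta> / real N - Fint (real x / real N) (\<rho> T)\<bar> \<le> \<zeta>)"

lemma supported_init: "1 \<le> N \<Longrightarrow> supported N (\<xi> N)"
  using \<xi>(1) by (simp add: approximates_def)

text \<open>The 1/2 pairs with thresholds of the form \<open>2 * g + 1\<close> below: a quantity
  with Markov bound \<open>g\<close> cannot exceed its threshold on an event of this
  probability.\<close>

lemma hydro_event_prob:
  assumes "0 < \<zeta>"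
  shows "\<forall>\<^sub>F N in sequentially. 1 / 2 < prob_at j N (\<xi> N) (real N ^ 2 * T) (hydro_event \<zeta> N)"
proof -
  have "(\<lambda>N. prob_at j N (\<xi> N) (real N ^ 2 * T) (hydro_event \<zeta> N)) \<longlonglongrightarrow> 1"
    using hydro \<xi>(1) assms T unfolding hydro_limit_def hydro_event_def[abs_def] by blast
  then show ?thesis by (rule order_tendstoD) simp
qed

lemma hydro_continuous: "continuous_on {0..1} (\<rho> T)"
proof -
  have c: "continuous_on ({0..} \<times> {0..1}) (\<lambda>(t, r). \<rho> t r)"
    using hydro by (simp add: hydro_limit_def)
  have "continuous_on {0..1} (\<lambda>r. (case (T, r) of (t, r) \<Rightarrow> \<rho> t r))"
    by (rule continuous_on_compose2[OF c]) (use T in \<open>auto intro!: continuous_intros\<close>)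
  then show ?thesis by simp
qed

text \<open>The particle number is not conserved, but up to time \<open>N^2 * T\<close> its squared
  deviation is typically of order \<open>N\<close>, negligible against \<open>N^2\<close>.\<close>

lemma hydro_mass: "Fint 0 (\<rho> T) = M"
proof (rule ccontr)
  assume "Fint 0 (\<rho> T) \<noteq> M"
  define \<zeta> where "\<zeta> = \<bar>Fint 0 (\<rho> T) - M\<bar> / 2"
  have \<zeta>: "0 < \<zeta>" using \<open>Fint 0 (\<rho> T) \<noteq> M\<close> by (simp add: \<zeta>_def)
  have "\<forall>\<^sub>F N in sequentially. \<zeta>^2 \<le> 0 + (3 + 4 * j * T) / real N"
    using hydro_event_prob[OF \<zeta>] eventually_ge_at_top[of 1]
  proof eventually_elim
    case (elim N)
    let ?t = "real N ^ 2 * T"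
    have Npos: "0 < real N" "1 \<le> real N" using elim by auto
    define B where "B = (Feps N 0 (\<xi> N) - real N * M)^2 + 2 * j / real N * ?t"
    have B0: "0 \<le> B" using j T by (simp add: B_def)
    have "\<exists>\<eta>. hydro_event \<zeta> N \<eta> \<and> (Feps N 0 \<eta> - real N * M)^2 < 2 * B + 1"
    proof (rule ccontr)
      assume "\<not> ?thesis"
      then have far: "2 * B + 1 \<le> (Feps N 0 \<eta> - real N * M)^2" if "hydro_event \<zeta> N \<eta>" for \<eta>
        using that by (meson not_less)
      have "(2 * B + 1) * prob_at j N (\<xi> N) ?t (hydro_event \<zeta> N)
          \<le> (Feps N 0 (\<xi> N) - real N * M)^2 + 2 * j / real N * ?t"
        using j M T B0 supported_init[of N] elim by (intro prob_at_mass far) auto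
      then have "(2 * B + 1) * prob_at j N (\<xi> N) ?t (hydro_event \<zeta> N) \<le> B"
        by (simp only: B_def[symmetric])
      moreover have "(2 * B + 1) * (1 / 2) < (2 * B + 1) * prob_at j N (\<xi> N) ?t (hydro_event \<zeta> N)"
        using elim B0 by (intro mult_strict_left_mono) auto
      ultimately show False by simp
    qed
    then obtain \<eta> where \<eta>: "hydro_event \<zeta> N \<eta>" "(Feps N 0 \<eta> - real N * M)^2 < 2 * B + 1" by blast
    have "\<bar>Feps N 0 \<eta> / real N - Fint 0 (\<rho> T)\<bar> \<le> \<zeta>"
      using \<eta>(1) unfolding hydro_event_def by force
    moreover have "\<bar>x - z\<bar> \<le> \<bar>y - x\<bar> + \<bar>y - z\<bar>" for x y z :: real by linarith
    ultimately have "\<bar>Fint 0 (\<rho> T) - M\<bar> \<le> \<zeta> + \<bar>Feps N 0 \<eta> / real N - M\<bar>"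
      by (meson add_right_mono order_trans)
    then have "\<zeta> \<le> \<bar>Feps N 0 \<eta> / real N - M\<bar>" by (simp add: \<zeta>_def)
    also have "\<dots> = \<bar>Feps N 0 \<eta> - real N * M\<bar> / real N"
      using Npos by (simp add: field_simps)
    finally have "real N * \<zeta> \<le> \<bar>Feps N 0 \<eta> - real N * M\<bar>" using Npos by (simp add: field_simps)
    then have "(real N * \<zeta>)^2 \<le> \<bar>Feps N 0 \<eta> - real N * M\<bar>^2" using \<zeta> by (intro power_mono) auto
    then have "real N^2 * \<zeta>^2 \<le> 2 * B + 1" using \<eta>(2) by (simp add: power_mult_distrib)
    moreover have "(Feps N 0 (\<xi> N) - real N * M)^2 \<le> 1"
      using \<xi>(2)[of N] elim by (simp add: abs_square_le_1)
    moreover have "2 * j / real N * ?t = real N * (2 * j * T)"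
      using Npos by (simp add: power2_eq_square)
    ultimately have "real N^2 * \<zeta>^2 \<le> 3 + real N * (4 * j * T)" unfolding B_def by simp
    also have "\<dots> \<le> real N * (3 + 4 * j * T)" using Npos by (simp add: algebra_simps)
    finally have "real N * (real N * \<zeta>^2) \<le> real N * (3 + 4 * j * T)"
      by (simp add: power2_eq_square mult.assoc)
    then have "real N * \<zeta>^2 \<le> 3 + 4 * j * T" using mult_le_cancel_left_pos[OF Npos(1)] by blast
    then show ?case using Npos by (simp add: pos_le_divide_eq mult.commute)
  qed
  then have "\<zeta>^2 \<le> 0" by (rule le_if_le_inverse_nat)
  then show False using \<zeta> by simp
qed

lemma hydro_decay:
  assumes r: "r \<in> {0..1}"
  shows "\<bar>Fint r (\<rho> T) - lin_tail j M r\<bar>^3 \<le> 64 * (M + 2 * j) * (M + 1)^2 * exp (- T / 8)"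
proof -
  define d where "d = (\<lambda>r. Fint r (\<rho> T) - lin_tail j M r)"
  define h where "h = \<bar>d r\<bar>"
  define K where "K = M + 2 * j"
  have K: "0 < K" using j M by (simp add: K_def)
  have d01: "d 0 = 0" "d 1 = 0"
    using hydro_mass lin_tail_0[OF j M] lin_tail_1[OF j M] by (auto simp: d_def Fint_def)
  have \<rho>0: "0 \<le> \<rho> T r" if "r \<in> {0..1}" for r using hydro T that by (auto simp: hydro_limit_def)
  obtain B where B: "\<And>r. r \<in> {0..1} \<Longrightarrow> \<bar>\<rho> T r\<bar> \<le> B"
  proof -
    have "bounded (\<rho> T ` {0..1})"
      by (intro compact_imp_bounded compact_continuous_image hydro_continuous) auto
    then obtain B where "\<forall>x\<in>{0..1}. \<bar>\<rho> T x\<bar> \<le> B" by (auto simp: bounded_iff)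
    then show thesis by (intro that[of B]) auto
  qed
  \<comment> \<open>Depends on the unknown density at time \<open>T\<close>, but will multiply only
    terms that vanish with \<open>\<delta>\<close> or \<open>1 / N\<close>.\<close>
  define \<Lambda> where "\<Lambda> = B + K"
  have \<Lambda>: "0 \<le> \<Lambda>" using B[of 0] K by (simp add: \<Lambda>_def)
  have dlip: "\<bar>d x - d y\<bar> \<le> \<Lambda> * \<bar>x - y\<bar>" if "x \<in> {0..1}" "y \<in> {0..1}" for x y
  proof -
    have "\<bar>d x - d y\<bar> \<le> \<bar>Fint x (\<rho> T) - Fint y (\<rho> T)\<bar> + \<bar>lin_tail j M x - lin_tail j M y\<bar>"
      by (simp add: d_def)
    also have "\<dots> \<le> B * \<bar>x - y\<bar> + K * \<bar>x - y\<bar>"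
      unfolding K_def
      by (intro add_mono Fint_lipschitz[OF hydro_continuous B] lin_tail_lipschitz[OF j M]) (use that in auto)
    finally show ?thesis by (simp add: \<Lambda>_def algebra_simps)
  qed
  have dle: "\<bar>d x\<bar> \<le> \<Lambda>" if "x \<in> {0..1}" for x
  proof -
    have "\<bar>d x\<bar> \<le> \<Lambda> * \<bar>x\<bar>" using dlip[of x 0] d01 that by simp
    also have "\<dots> \<le> \<Lambda> * 1" using that \<Lambda> by (intro mult_left_mono) auto
    finally show ?thesis by simp
  qed
  obtain \<alpha> where \<alpha>: "0 \<le> \<alpha>" "\<alpha> + h / (2 * K) \<le> 1"
    and far: "\<And>s. s \<in> {\<alpha>..\<alpha> + h / (2 * K)} \<Longrightarrow> h / 2 \<le> \<bar>d s\<bar>"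
  proof -
    have "\<exists>\<alpha>\<ge>0. \<alpha> + h / (2 * K) \<le> 1 \<and> (\<forall>s\<in>{\<alpha>..\<alpha> + h / (2 * K)}. h / 2 \<le> \<bar>d s\<bar>)"
      unfolding h_def d_def K_def
      using d01 K r Fint_antimono[OF hydro_continuous \<rho>0] lin_tail_lipschitz[OF j M]
      by (intro deviation_persists) (auto simp: d_def K_def)
    then show thesis using that by blast
  qed
  define X where "X = 4 * (M + 1)^2 * exp (- T / 8)"
  \<comment> \<open>The left side is \<open>(h / 2)^2\<close> times the interval length
    \<open>h / (2 * K)\<close>. The parameter \<open>\<delta>\<close> sets both the smoothing length
    \<open>\<delta> * N\<close> and the accuracy \<open>\<delta>^2\<close> of the hydrodynamic
    event.\<close>
  have "h^3 / (8 * K) \<le> 2 * X + (8 * j^2 * T + 2 * \<Lambda> + 2 * \<Lambda>^2) * \<delta>^2" if \<delta>: "0 < \<delta>" for \<delta>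
  proof (rule le_if_le_inverse_nat)
    define C where "C = (1 / \<delta>^2 + 1 / \<delta>) * (T * (1 + M)^2 + j * T^2) + T * ((1 + 2 * M) / \<delta> + j)"
    define P where "P = 2 * X + (8 * j^2 * T + 2 * \<Lambda> + 2 * \<Lambda>^2) * \<delta>^2"
    define Q where "Q = 2 * C + 1 + 2 * \<Lambda> * M + h^2 / 4"
    show "\<forall>\<^sub>F N in sequentially. h^3 / (8 * K)
      \<le> 2 * X + (8 * j^2 * T + 2 * \<Lambda> + 2 * \<Lambda>^2) * \<delta>^2 + (2 * C + 1 + 2 * \<Lambda> * M + h^2 / 4) / real N"
      using hydro_event_prob[OF zero_less_power[OF \<delta>, of 2]] eventually_ge_at_top[of 1]
        eventually_ge_at_top[of "nat \<lceil>j\<rceil>"]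
    proof (eventually_elim, goal_cases)
      case (1 N)
      then have N: "1 \<le> N" "j \<le> real N" and prob: "1 / 2 < prob_at j N (\<xi> N) (real N ^ 2 * T) (hydro_event (\<delta>^2) N)"
        by (auto simp: nat_ceiling_le_eq)
      let ?N = "real N" and ?t = "real N ^ 2 * T" and ?\<kappa> = "(\<delta> * real N)^2"
      have Npos: "0 < ?N" "1 \<le> ?N" using N by auto
      have \<kappa>: "0 < ?\<kappa>" using \<delta> Npos by simp
      have t: "0 \<le> ?t" using T by simp
      define g where "g = energy_bound j M ?\<kappa> N ?t (\<xi> N)"
      have g0: "0 \<le> g" unfolding g_def
        by (rule prob_at_energy(2)[OF j M \<kappa> N t supported_init[OF N(1)], of 1 "\<lambda>_. False"]) auto
      have g: "g \<le> ?N^3 * (X + 4 * \<delta>^2 * j^2 * T) + ?N^2 * C"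
        using energy_bound_le[OF j M \<delta> N(1) T \<xi>(2)[OF N(1)]] by (simp add: g_def X_def C_def)
      have "\<exists>\<eta>. hydro_event (\<delta>^2) N \<eta> \<and> energy ?\<kappa> N (deviation j M N \<eta>) < 2 * g + 1"
      proof (rule ccontr)
        assume "\<not> ?thesis"
        then have "(2 * g + 1) * prob_at j N (\<xi> N) ?t (hydro_event (\<delta>^2) N) \<le> g"
          unfolding g_def using g0
          by (intro prob_at_energy(1)[OF j M \<kappa> N t supported_init[OF N(1)]])
             (auto simp: g_def[symmetric] not_less)
        moreover have "(2 * g + 1) * (1 / 2) < (2 * g + 1) * prob_at j N (\<xi> N) ?t (hydro_event (\<delta>^2) N)"
          using prob g0 by (intro mult_strict_left_mono) auto
        ultimately show False by simp
      qed
      then obtain \<eta> where ev: "hydro_event (\<delta>^2) N \<eta>"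
        and en: "energy ?\<kappa> N (deviation j M N \<eta>) < 2 * g + 1" by blast
      define w where "w = deviation j M N \<eta>"
      \<comment> \<open>The rescaled deviation of the limit serves as test function. Its increments
        are bounded by \<open>\<Lambda>\<close>, so its Dirichlet form is of order \<open>N\<close>,
        and the smoothing term costs only order \<open>\<delta>^2 * N^3\<close>.\<close>
      define z where "z = (\<lambda>y. if y \<le> N then ?N * d (real y / ?N) else 0)"
      have z0: "z 0 = 0" "z (Suc N) = 0" using d01 by (auto simp: z_def)
      have unit: "real y / ?N \<in> {0..1}" if "y \<le> N" for y using that Npos by simp
      have zle: "\<bar>z y\<bar> \<le> ?N * \<Lambda>" if "y \<le> N" for y
        using mult_left_mono[OF dle[OF unit[OF that]], of ?N] that by (simp add: z_def abs_mult)
      have wz: "\<bar>w y - z y\<bar> \<le> ?N * \<delta>^2 + M" if "y \<le> N" for y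
      proof -
        have "\<bar>Feps N y \<eta> / ?N - Fint (real y / ?N) (\<rho> T)\<bar> \<le> \<delta>^2"
          using ev that by (simp add: hydro_event_def)
        then have "?N * \<bar>Feps N y \<eta> / ?N - Fint (real y / ?N) (\<rho> T)\<bar> \<le> ?N * \<delta>^2"
          by (intro mult_left_mono) auto
        also have "?N * \<bar>Feps N y \<eta> / ?N - Fint (real y / ?N) (\<rho> T)\<bar>
            = \<bar>?N * (Feps N y \<eta> / ?N - Fint (real y / ?N) (\<rho> T))\<bar>" by (simp add: abs_mult)
        also have "?N * (Feps N y \<eta> / ?N - Fint (real y / ?N) (\<rho> T))
            = Feps N y \<eta> - ?N * Fint (real y / ?N) (\<rho> T)" using Npos by (simp add: field_simps)
        finally have "\<bar>Feps N y \<eta> - ?N * Fint (real y / ?N) (\<rho> T)\<bar> \<le> ?N * \<delta>^2" .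
        moreover have "\<bar>lattice_tail j M N y - ?N * lin_tail j M (real y / ?N)\<bar> \<le> M"
          by (rule lattice_tail_approx[OF j M N(1) that])
        moreover have "z y = ?N * Fint (real y / ?N) (\<rho> T) - ?N * lin_tail j M (real y / ?N)"
          using that by (simp add: z_def d_def algebra_simps)
        ultimately show ?thesis unfolding w_def deviation_def by linarith
      qed
      have cross: "ip N z z - ?N * ((?N * \<delta>^2 + M) * (?N * \<Lambda>)) \<le> ip N w z"
      proof -
        have "ip N z z - ip N w z = (\<Sum>y=1..N. (z y - w y) * z y)"
          by (simp add: ip_def sum_subtractf[symmetric] algebra_simps)
        also have "\<dots> \<le> (\<Sum>y=1..N. (?N * \<delta>^2 + M) * (?N * \<Lambda>))"
        proof (rule sum_mono)
          fix y assume "y \<in> {1..N}"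
          then have "\<bar>z y - w y\<bar> * \<bar>z y\<bar> \<le> (?N * \<delta>^2 + M) * (?N * \<Lambda>)"
            using wz[of y] zle[of y] M Npos by (intro mult_mono) (auto simp: abs_minus_commute)
          then show "(z y - w y) * z y \<le> (?N * \<delta>^2 + M) * (?N * \<Lambda>)"
            using abs_le_D1[of "(z y - w y) * z y"] by (simp add: abs_mult)
        qed
        finally show ?thesis by simp
      qed
      have dz: "dirichlet N z z \<le> 2 * ?N * \<Lambda>^2"
      proof -
        have "(z (Suc y) - z y) * (z (Suc y) - z y) \<le> \<Lambda>^2" if "y \<le> N" for y
        proof -
          have "\<bar>z (Suc y) - z y\<bar> \<le> \<Lambda>"
          proof (cases "y = N")
            case True
            then show ?thesis using d01 \<Lambda> Npos by (simp add: z_def)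
          next
            case False
            then have y: "Suc y \<le> N" using that by simp
            have "\<bar>d (real (Suc y) / ?N) - d (real y / ?N)\<bar> \<le> \<Lambda> * \<bar>real (Suc y) / ?N - real y / ?N\<bar>"
              by (intro dlip unit y that)
            also have "real (Suc y) / ?N - real y / ?N = 1 / ?N"
              by (simp add: diff_divide_distrib[symmetric])
            finally have "?N * \<bar>d (real (Suc y) / ?N) - d (real y / ?N)\<bar> \<le> ?N * (\<Lambda> * \<bar>1 / ?N\<bar>)"
              by (intro mult_left_mono) auto
            also have "\<dots> = \<Lambda>" using Npos by simp
            also have "?N * \<bar>d (real (Suc y) / ?N) - d (real y / ?N)\<bar>
              = \<bar>?N * (d (real (Suc y) / ?N) - d (real y / ?N))\<bar>" by (simp add: abs_mult)
            also have "?N * (d (real (Suc y) / ?N) - d (real y / ?N)) = z (Suc y) - z y"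
              using y by (simp add: z_def right_diff_distrib)
            finally show ?thesis .
          qed
          then have "\<bar>z (Suc y) - z y\<bar>^2 \<le> \<Lambda>^2" by (intro power_mono) auto
          then show ?thesis by (simp add: power2_eq_square)
        qed
        then have "dirichlet N z z \<le> (\<Sum>y=0..N. \<Lambda>^2)" unfolding dirichlet_def by (intro sum_mono) auto
        also have "\<dots> = (?N + 1) * \<Lambda>^2" by simp
        also have "\<dots> \<le> 2 * ?N * \<Lambda>^2" using Npos by (intro mult_right_mono) auto
        finally show ?thesis .
      qed
      have var: "2 * ip N w z - ip N z z - ?\<kappa> * dirichlet N z z \<le> 2 * g + 1"
        using energy_variational[OF \<kappa> z0, of w] en by (simp add: w_def)
      have lower: "(h / (2 * K) * ?N - 1) * (?N * (h / 2))^2 \<le> ip N z z"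
        by (rule ip_lower_bound[OF N(1) \<alpha> _ _ far]) (use K in \<open>auto simp: h_def z_def\<close>)
      have "?\<kappa> * dirichlet N z z \<le> ?\<kappa> * (2 * ?N * \<Lambda>^2)" using \<kappa> dz by (intro mult_left_mono) auto
      moreover have "l \<le> 2 * G + 1 + 2 * e + D'"
        if "D \<le> D'" "l \<le> zz" "2 * wz - zz - D \<le> 2 * g + 1" "zz - e \<le> wz" "g \<le> G"
        for l zz wz D D' e g G :: real
        using that by linarith
      ultimately have "(h / (2 * K) * ?N - 1) * (?N * (h / 2))^2
          \<le> 2 * (?N^3 * (X + 4 * \<delta>^2 * j^2 * T) + ?N^2 * C) + 1
            + 2 * (?N * ((?N * \<delta>^2 + M) * (?N * \<Lambda>))) + ?\<kappa> * (2 * ?N * \<Lambda>^2)"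
        using lower var cross g by blast
      also have "\<dots> = ?N^3 * P + (?N^2 * (2 * C + 2 * \<Lambda> * M) + 1)"
        by (simp add: P_def algebra_simps power2_eq_square power3_eq_cube)
      also have "\<dots> \<le> ?N^3 * P + (?N^2 * (2 * C + 2 * \<Lambda> * M) + ?N^2)"
        using Npos by (intro add_left_mono) simp
      also have "\<dots> = ?N^3 * P + ?N^2 * Q - ?N^2 * (h^2 / 4)"
        by (simp add: Q_def algebra_simps)
      also have "(h / (2 * K) * ?N - 1) * (?N * (h / 2))^2 = ?N^3 * (h^3 / (8 * K)) - ?N^2 * (h^2 / 4)"
        by (simp add: algebra_simps diff_divide_distrib add_divide_distrib power2_eq_square power3_eq_cube)
      finally have "?N^3 * (h^3 / (8 * K)) \<le> ?N^3 * P + ?N^2 * Q" by simp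
      also have "\<dots> = ?N^3 * (P + Q / ?N)"
        using Npos by (simp add: distrib_left power2_eq_square power3_eq_cube)
      finally have "h^3 / (8 * K) \<le> P + Q / ?N"
        using mult_le_cancel_left_pos[OF zero_less_power[OF Npos(1), of 3]] by blast
      then show ?case unfolding P_def Q_def .
    qed
  qed
  then have "h^3 / (8 * K) \<le> 2 * X" by (rule le_if_le_square)
  then show ?thesis using K by (simp add: h_def d_def X_def K_def field_simps)
qed

end

theorem theorem2p8:
  fixes j M :: real and \<rho>init :: "real \<Rightarrow> real"
  assumes "j > 0"
    and "continuous_on {0..1} \<rho>init"
    and "\<forall>r\<in>{0..1}. \<rho>init r \<ge> 0"
    and "integral {0..1} \<rho>init = M"
  shows "\<exists>a0>0. \<exists>b0<1. \<forall>a b. 0 < a \<and> a < a0 \<and> b0 < b \<and> b < 1 \<longrightarrow>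
           (\<forall>\<rho>. hydro_limit j a b \<rho>init \<rho> \<longrightarrow>
              ((\<lambda>t. SUP r\<in>{0..1}. \<bar>Fint r (\<rho> t) - Fint r (rho_lin j M)\<bar>) \<longlongrightarrow> 0) at_top)"
\<comment> \<open>With 1/2 for both thresholds, \<open>a < b\<close> holds, as the construction of
  the approximating configurations requires.\<close>
proof (intro exI[of _ "1/2"] conjI allI impI)
  fix a b :: real and \<rho> :: "real \<Rightarrow> real \<Rightarrow> real"
  assume ab: "0 < a \<and> a < 1 / 2 \<and> 1 / 2 < b \<and> b < 1" and hydro: "hydro_limit j a b \<rho>init \<rho>"
  have M: "0 \<le> M"
    unfolding assms(4)[symmetric]
    using assms by (intro integral_nonneg integrable_continuous_real) auto
  have "\<exists>\<xi>. approximates a b \<xi> \<rho>init \<and> (\<forall>N\<ge>1. \<bar>Feps N 0 (\<xi> N) - real N * M\<bar> \<le> 1)"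
    unfolding assms(4)[symmetric] using assms ab by (intro ex_approximates) auto
  then obtain \<xi> where \<xi>: "approximates a b \<xi> \<rho>init" "\<And>N. 1 \<le> N \<Longrightarrow> \<bar>Feps N 0 (\<xi> N) - real N * M\<bar> \<le> 1"
    by blast
  let ?C = "64 * (M + 2 * j) * (M + 1)^2"
  let ?D = "\<lambda>t r. \<bar>Fint r (\<rho> t) - Fint r (rho_lin j M)\<bar>"
  have bound: "?D t r \<le> root 3 (?C * exp (- t / 8))" if "0 \<le> t" "r \<in> {0..1}" for t r
  proof -
    have "(?D t r)^3 \<le> ?C * exp (- t / 8)"
      using hydro_decay[OF assms(1) M that(1) hydro \<xi> that(2)] Fint_rho_lin[OF assms(1) M, of r] that
      by simp
    then have "root 3 ((?D t r)^3) \<le> root 3 (?C * exp (- t / 8))" by (intro real_root_le_mono) auto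
    then show ?thesis by (simp add: real_root_power_cancel)
  qed
  show "((\<lambda>t. SUP r\<in>{0..1}. ?D t r) \<longlongrightarrow> 0) at_top"
  proof (rule tendsto_sandwich)
    show "\<forall>\<^sub>F t in at_top. 0 \<le> (SUP r\<in>{0..1}. ?D t r)"
      using eventually_ge_at_top[of 0]
    proof eventually_elim
      case (elim t)
      have "bdd_above (?D t ` {0..1})" using bound[OF elim] by (intro bdd_aboveI2) auto
      then have "?D t 0 \<le> (SUP r\<in>{0..1}. ?D t r)" by (rule cSUP_upper[rotated]) simp
      then show ?case by (rule order_trans[rotated]) simp
    qed
    show "\<forall>\<^sub>F t in at_top. (SUP r\<in>{0..1}. ?D t r) \<le> root 3 (?C * exp (- t / 8))"
      using eventually_ge_at_top[of 0] by eventually_elim (rule cSUP_least, use bound in auto)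
    have "filterlim (\<lambda>t::real. (- 1 / 8) * t) at_bot at_top"
      by (rule filterlim_tendsto_neg_mult_at_bot[OF tendsto_const _ filterlim_ident]) simp
    then have "((\<lambda>t::real. exp (- t / 8)) \<longlongrightarrow> 0) at_top"
      by (intro filterlim_compose[OF exp_at_bot]) simp
    then have "((\<lambda>t. root 3 (?C * exp (- t / 8))) \<longlongrightarrow> root 3 (?C * 0)) at_top"
      by (intro tendsto_intros)
    then show "((\<lambda>t. root 3 (?C * exp (- t / 8))) \<longlongrightarrow> 0) at_top" by simp
  qed simp
qed auto

end
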